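(* Let $F$ be a number field with $r\ge 1$ real places and $c$ complex places. Assume that $\widetilde{\mathcal{C}\ell}_F\simeq\bigoplus_{j=1}^{\nu}\mathbb{Z}/2^{n_j}\mathbb{Z}$ with $1\le n_1\le\dots\le n_\nu$, and let $\mathfrak a_1,\dots,\mathfrak a_\nu\in\widetilde{\mathcal{D}\ell}_F$ be representatives of the corresponding generating classes (the class of $\mathfrak a_j$ generating the $j$-th cyclic factor, of order $2^{n_j}$). For each $j$ choose $\alpha_j\in\mathcal R_F$ with $2^{n_j}\mathfrak a_j=\widetilde{\mathrm{div}}_F(\alpha_j)$ and define $c_{\nu+i,j}\in\{0,1\}$ $(1\le i\le r)$ by $$\mathrm{sign}^\infty_F(\alpha_j)=\big((-1)^{c_{\nu+1,j}},\dots,(-1)^{c_{\nu+r,j}}\big).$$ Let the group of logarithmic units be $\widetilde{\mathcal E}_F=\{\pm1\}\times\langle\tilde\varepsilon_1,\dots,\tilde\varepsilon_{r+c}\rangle$ (as a $\mathbb{Z}_2$-module, written multiplicatively), and define $b_{i,k}\in\{0,1\}$ $(1\le i\le r,\ 1\le k\le r+c)$ by $$\mathrm{sign}^\infty_F(\tilde\varepsilon_k)=\prod_{i=1}^r\epsilon_i^{b_{i,k}},$$ where $\epsilon_1,\dots,\epsilon_r$ is the canonical basis of $\{\pm1\}^r$. Then the classes of $(\mathfrak a_j,\mathbf 1)$ $(1\le j\le\nu)$ together with the classes of $(0,\epsilon_i)$ $(1\le i\le r)$ generate the narrow logarithmic class group $\widetilde{\mathcal{C}\ell}{}_F^{\,res}$,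 and the $\mathbb{Z}_2$-module of relations among these $\nu+r$ generators (taken in this order) is generated by the columns of the matrix $$R=\begin{pmatrix}\mathrm{diag}(2^{n_1},\dots,2^{n_\nu}) & 0 & 0 & 0\\ (c_{\nu+i,j})_{1\le i\le r,\,1\le j\le\nu} & 2I_r & (b_{i,k})_{1\le i\le r,\,1\le k\le r+c} & \mathbf{e}\end{pmatrix}\in\mathbb{Z}_2^{(\nu+r)\times(\nu+2r+c+1)},$$ where $I_r$ is the $r\times r$ identity matrix and $\mathbf e=(1,\dots,1)^{tr}\in\mathbb{Z}_2^r$.
   Context: Let $F$ be a number field with $r$ real places and put $\mathcal R_F:=\mathbb{Z}_2\otimes_{\mathbb{Z}}F^\times$ (written multiplicatively). Logarithmic valuations: for a finite place $\mathfrak p$ of $F$ with residue field of $N\mathfrak p$ elements and normalized valuation $v_{\mathfrak p}$, the 2-adic absolute value of $x\in F^\times$ at $\mathfrak p$ is $|x|_{\mathfrak p}=N\mathfrak p^{-v_{\mathfrak p}(x)}$ if $\mathfrak p\nmid 2$, and $|x|_{\mathfrak p}=N_{F_{\mathfrak p}/\mathbb{Q}_2}(x)\,N\mathfrak p^{-v_{\mathfrak p}(x)}$ if $\mathfrak p\mid 2$; it lies in $\mathbb{Z}_2^\times$. With $\mathrm{Log}$ the 2-adic logarithm, $\mathrm{Log}|\cdot|_{\mathfrak p}$ extends $\mathbb{Z}_2$-linearly to $\mathcal R_F$, and the degree $\deg_F\mathfrak p\in\mathbb{Z}_2$ is a fixed generator of its image. The logarithmic valuation is $\tilde v_{\mathfrak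 p}(x)=-\mathrm{Log}|x|_{\mathfrak p}/\deg_F\mathfrak p\in\mathbb{Z}_2$. Logarithmic divisors: $\mathcal{D}\ell_F=\bigoplus_{\mathfrak p}\mathbb{Z}_2\,\mathfrak p$ over all finite places; $\deg_F(\sum a_{\mathfrak p}\mathfrak p)=\sum a_{\mathfrak p}\deg_F\mathfrak p$; $\widetilde{\mathcal{D}\ell}_F=\ker(\deg_F)$; $\widetilde{\mathrm{div}}_F(\alpha)=\sum_{\mathfrak p}\tilde v_{\mathfrak p}(\alpha)\mathfrak p$ for $\alpha\in\mathcal R_F$, which lies in $\widetilde{\mathcal{D}\ell}_F$; $\widetilde{\mathcal{P}\ell}_F=\widetilde{\mathrm{div}}_F(\mathcal R_F)$; and $\widetilde{\mathcal{C}\ell}_F=\widetilde{\mathcal{D}\ell}_F/\widetilde{\mathcal{P}\ell}_F$ is the 2-group of logarithmic divisor classes of degree 0. The group of logarithmic units is $\widetilde{\mathcal E}_F=\{x\in\mathcal R_F:\tilde v_{\mathfrak p}(x)=0\text{ for all finite }\mathfrak p\}$. Signs: $\mathrm{sign}_F^\infty:F^\times\to\{\pm1\}^r$ maps $x$ to the vector of signs of its real conjugates, extended $\mathbb{Z}_2$-linearly to $\mathcal R_F$. The element $\epsilon_i\in\{\pm1\}^r$ has $-1$ in position $i$ and $1$ elsewhere; $\mathbf 1=(1,\dots,1)$. Narrow classes: $\widetilde{\mathcal{D}\ell}{}_F^{\,res}=\widetilde{\mathcal{D}\ell}_F\oplus\{\pm1\}^r$, $\widetilde{\mathcal{P}\ell}{}_F^{\,res}=\{(\widetilde{\mathrm{div}}_F(\alpha),\mathrm{sign}_F^\infty(\alpha)):\alpha\in\mathcal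 R_F\}$, and $\widetilde{\mathcal{C}\ell}{}_F^{\,res}=\widetilde{\mathcal{D}\ell}{}_F^{\,res}/\widetilde{\mathcal{P}\ell}{}_F^{\,res}$. A relation among generators $g_1,\dots,g_{\nu+r}$ of a $\mathbb{Z}_2$-module (written additively) is a vector $(x_1,\dots,x_{\nu+r})\in\mathbb{Z}_2^{\nu+r}$ with $\sum x_kg_k=0$. *)

theory Defs
  imports
    "HOL-Algebra.QuotRing"
    "HOL-Algebra.Product_Groups"
    "HOL-Algebra.Elementary_Groups"
    "HOL-Computational_Algebra.Fraction_Field"
    "Jordan_Normal_Form.VS_Connect"
begin

hide_const (open) Multiset.mult Polynomial.smult Modules.module

section \<open>The rings \<open>\<int>\<^sub>2\<close> and \<open>\<rat>\<^sub>2\<close>\<close>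

text \<open>\<open>z2\<close> is the inverse limit of the rings \<open>\<int>/2\<^sup>n\<int>\<close>: an element is the coherent
  sequence of its least nonnegative residues. The field \<open>\<rat>\<^sub>2\<close> is \<open>z2 fract\<close>.\<close>

typedef z2 = "{f :: nat \<Rightarrow> int. \<forall>n. 0 \<le> f n \<and> f n < 2 ^ n \<and> f (Suc n) mod 2 ^ n = f n}"
  morphisms residue Abs_z2
  by (rule exI[of _ "\<lambda>_. 0"]) simp

setup_lifting type_definition_z2

lemma mod_Suc_pow: "(x mod 2 ^ Suc n) mod 2 ^ n = x mod (2 ^ n :: int)"
  by (simp add: mod_mod_cancel)

lemma residue_mod [simp]: "residue x n mod 2 ^ n = residue x n"
  using residue[of x] by simp

lemma residue_Suc: "residue x (Suc n) mod 2 ^ n = residue x n"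
  using residue[of x] by simp

instantiation z2 :: comm_ring_1
begin

lift_definition zero_z2 :: z2 is "\<lambda>_. 0" by simp

lift_definition one_z2 :: z2 is "\<lambda>n. 1 mod 2 ^ n"
  by (simp only: mod_Suc_pow) simp

lift_definition plus_z2 :: "z2 \<Rightarrow> z2 \<Rightarrow> z2" is "\<lambda>f g n. (f n + g n) mod 2 ^ n"
  by (simp only: mod_Suc_pow) (metis mod_add_eq pos_mod_bound pos_mod_sign zero_less_numeral zero_less_power)

lift_definition minus_z2 :: "z2 \<Rightarrow> z2 \<Rightarrow> z2" is "\<lambda>f g n. (f n - g n) mod 2 ^ n"
  by (simp only: mod_Suc_pow) (metis mod_diff_eq pos_mod_bound pos_mod_sign zero_less_numeral zero_less_power)

lift_definition uminus_z2 :: "z2 \<Rightarrow> z2" is "\<lambda>f n. (- f n) mod 2 ^ n"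
  by (simp only: mod_Suc_pow) (metis mod_minus_eq pos_mod_bound pos_mod_sign zero_less_numeral zero_less_power)

lift_definition times_z2 :: "z2 \<Rightarrow> z2 \<Rightarrow> z2" is "\<lambda>f g n. (f n * g n) mod 2 ^ n"
  by (simp only: mod_Suc_pow) (metis mod_mult_eq pos_mod_bound pos_mod_sign zero_less_numeral zero_less_power)

instance
proof
  fix a b c :: z2
  show "a * b * c = a * (b * c)"
    by transfer (auto simp: mod_simps mult.assoc)
  show "a * b = b * a"
    by transfer (auto simp: mult.commute)
  show "1 * a = a"
  proof (rule residue_inject[THEN iffD1], rule ext)
    fix n
    have "residue (1 * a) n = (1 mod 2 ^ n * residue a n) mod 2 ^ n"
      by (simp only: times_z2.rep_eq one_z2.rep_eq)
    also have "\<dots> = residue a n"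
      by (simp only: mod_mult_left_eq mult_1_left residue_mod)
    finally show "residue (1 * a) n = residue a n" .
  qed
  show "a + b + c = a + (b + c)"
    by transfer (auto simp: mod_simps add.assoc)
  show "a + b = b + a"
    by transfer (auto simp: add.commute)
  show "0 + a = a"
    by transfer (auto simp: fun_eq_iff)
  show "- a + a = 0"
    by transfer (auto simp: mod_simps fun_eq_iff)
  show "a - b = a + - b"
    by transfer (auto simp: mod_simps)
  show "(a + b) * c = a * c + b * c"
    by transfer (auto simp: mod_simps algebra_simps)
  show "(0::z2) \<noteq> 1"
    by transfer (auto simp: fun_eq_iff intro!: exI[of _ 1])
qed

end

lemma residue_add_mod: "residue x (n + m) mod 2 ^ n = residue x n"
proof (induction m)
  case (Suc m)
  have "residue x (n + Suc m) mod 2 ^ n = (residue x (Suc (n + m)) mod 2 ^ (n + m)) mod 2 ^ n"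
    by (simp add: mod_mod_cancel le_imp_power_dvd)
  then show ?case using Suc by (simp add: residue_Suc)
qed simp

lemma pow2_dvd_mult_int:
  fixes a b :: int
  assumes "2 ^ (n + m) dvd a * b"
  shows "2 ^ n dvd a \<or> 2 ^ m dvd b"
proof (cases "a * b = 0")
  case False
  then have ne: "a \<noteq> 0" "b \<noteq> 0" by auto
  have "n + m \<le> multiplicity 2 (a * b)"
    using assms False by (intro multiplicity_geI) auto
  also have "\<dots> = multiplicity 2 a + multiplicity 2 b"
    using ne by (intro prime_elem_multiplicity_mult_distrib) auto
  finally have "n \<le> multiplicity 2 a \<or> m \<le> multiplicity 2 b" by linarith
  then show ?thesis by (auto intro: multiplicity_dvd')
qed auto

instance z2 :: idom
proof
  fix a b :: z2
  assume "a \<noteq> 0" "b \<noteq> 0"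
  then obtain n m where nz: "residue a n \<noteq> 0" "residue b m \<noteq> 0"
    by (auto simp: residue_inject[symmetric] zero_z2.rep_eq fun_eq_iff)
  have "residue (a * b) (n + m) \<noteq> 0"
  proof
    assume "residue (a * b) (n + m) = 0"
    then have "2 ^ (n + m) dvd residue a (n + m) * residue b (n + m)"
      by (simp add: times_z2.rep_eq mod_eq_0_iff_dvd)
    then have "2 ^ n dvd residue a (n + m) \<or> 2 ^ m dvd residue b (n + m)"
      by (rule pow2_dvd_mult_int)
    then show False
      using nz residue_add_mod[of a n m] residue_add_mod[of b m n]
      by (metis add.commute dvd_imp_mod_0)
  qed
  then show "a * b \<noteq> 0" by (auto simp: zero_z2.rep_eq)
qed

text \<open>Convergence in \<open>\<rat>\<^sub>2\<close>, with the sets \<open>2\<^sup>k \<int>\<^sub>2\<close> as neighbourhood basis of \<open>0\<close>.\<close>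

definition q2_tendsto :: "(nat \<Rightarrow> z2 fract) \<Rightarrow> z2 fract \<Rightarrow> bool" where
  "q2_tendsto s l \<longleftrightarrow> (\<forall>k. \<exists>m. \<forall>n\<ge>m. \<exists>z. s n - l = to_fract (2 ^ k * z))"

text \<open>The 2-adic logarithm. Every \<open>u \<in> \<int>\<^sub>2\<^sup>\<times>\<close> is a principal unit, so on \<open>\<int>\<^sub>2\<^sup>\<times>\<close> it is the usual
  power series; elsewhere on \<open>\<rat>\<^sub>2\<^sup>\<times>\<close> it is Iwasawa's branch, for which \<open>Log 2 = 0\<close>.\<close>

definition Log2 :: "z2 fract \<Rightarrow> z2 fract" where
  "Log2 x = (THE l. \<exists>m :: int. \<exists>u :: z2. u dvd 1 \<and> x = 2 powi m * to_fract u \<and>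
     q2_tendsto (\<lambda>n. \<Sum>k = 1..n. (- 1) ^ (k + 1) * (to_fract u - 1) ^ k / of_nat k) l)"


section \<open>Modules over \<open>\<int>\<^sub>2\<close>\<close>

text \<open>The \<open>mult\<close> and \<open>one\<close> fields of a record of type \<open>module\<close> are irrelevant here. The ring
  \<open>\<int>\<^sub>2\<close> of scalars is \<open>class_ring\<close> at type \<open>z2\<close>.\<close>

definition free_module :: "'b set \<Rightarrow> (z2, 'b \<Rightarrow> z2) module" where
  "free_module S = \<lparr>carrier = {f. finite {s. f s \<noteq> 0} \<and> (\<forall>s. s \<notin> S \<longrightarrow> f s = 0)},
     mult = undefined, one = undefined, zero = (\<lambda>_. 0),
     add = (\<lambda>f g s. f s + g s), smult = (\<lambda>c f s. c * f s)\<rparr>"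

definition basis_vec :: "'b \<Rightarrow> 'b \<Rightarrow> z2" where
  "basis_vec s = (\<lambda>t. if t = s then 1 else 0)"

definition quot_module :: "('c, 'm) module \<Rightarrow> 'm set \<Rightarrow> ('c, 'm set) module" where
  "quot_module M N = \<lparr>carrier = a_rcosets\<^bsub>M\<^esub> N,
     mult = undefined, one = undefined, zero = N, add = (<+>\<^bsub>M\<^esub>),
     smult = (\<lambda>c X. \<Union>x\<in>X. N +>\<^bsub>M\<^esub> (c \<odot>\<^bsub>M\<^esub> x))\<rparr>"

definition q2_module :: "(z2, z2 fract) module" where
  "q2_module = \<lparr>carrier = UNIV, mult = (*), one = 1, zero = 0, add = (+),
     smult = (\<lambda>c x. to_fract c * x)\<rparr>"

text \<open>The group \<open>{\<plusminus>1}\<^sup>r\<close>, with multiplication as module addition; the scalar \<open>c\<close> acts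
  as \<open>s \<mapsto> s\<^sup>c\<close>.\<close>

definition sign_module :: "nat \<Rightarrow> (z2, nat \<Rightarrow> int) module" where
  "sign_module r = \<lparr>carrier = {..<r} \<rightarrow>\<^sub>E {1, - 1},
     mult = undefined, one = undefined, zero = (\<lambda>i\<in>{..<r}. 1),
     add = (\<lambda>s t. \<lambda>i\<in>{..<r}. s i * t i),
     smult = (\<lambda>c s. \<lambda>i\<in>{..<r}. if 2 dvd c then 1 else s i)\<rparr>"

definition sign_basis :: "nat \<Rightarrow> nat \<Rightarrow> nat \<Rightarrow> int" where
  "sign_basis r i = (\<lambda>j\<in>{..<r}. if j = i then - 1 else 1)"

definition relation_module :: "(z2, 'm) module \<Rightarrow> nat \<Rightarrow> (nat \<Rightarrow> 'm) \<Rightarrow> z2 vec set" where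
  "relation_module M n g =
     {x \<in> carrier_vec n. (\<Oplus>\<^bsub>M\<^esub>k\<in>{..<n}. (x $ k) \<odot>\<^bsub>M\<^esub> g k) = \<zero>\<^bsub>M\<^esub>}"


section \<open>Number fields and their places\<close>

class number_field = field_char_0 +
  assumes finite_degree: "\<exists>B. finite B \<and> (\<forall>x. \<exists>q. x = (\<Sum>b\<in>B. of_rat (q b) * b))"

instance rat :: number_field
  by standard (rule exI[of _ "{1}"], auto simp: of_rat_eq_id)

definition real_embeddings :: "('a :: number_field \<Rightarrow> real) set" where
  "real_embeddings = {\<sigma>. field_hom \<sigma>}"

definition complex_places :: "('a :: number_field \<Rightarrow> complex) set set" where
  "complex_places = {{\<tau>, cnj \<circ> \<tau>} | \<tau>. field_hom \<tau> \<and> \<not> range \<tau> \<subseteq> \<real>}"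

text \<open>A finite place is given by its normalized discrete valuation, with the dummy value \<open>0\<close>
  at \<open>0\<close> (so that distinct functions are distinct places).\<close>

definition finite_places :: "('a :: number_field \<Rightarrow> int) set" where
  "finite_places = {v. v 0 = 0 \<and>
     (\<forall>x y. x \<noteq> 0 \<longrightarrow> y \<noteq> 0 \<longrightarrow> v (x * y) = v x + v y) \<and>
     (\<forall>x y. x \<noteq> 0 \<longrightarrow> y \<noteq> 0 \<longrightarrow> x + y \<noteq> 0 \<longrightarrow> min (v x) (v y) \<le> v (x + y)) \<and>
     v ` (- {0}) = UNIV}"

definition val_ge :: "('a :: number_field \<Rightarrow> int) \<Rightarrow> 'a \<Rightarrow> int \<Rightarrow> bool" where
  "val_ge v x k \<longleftrightarrow> x = 0 \<or> k \<le> v x"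

definition valuation_ring :: "('a :: number_field \<Rightarrow> int) \<Rightarrow> 'a ring" where
  "valuation_ring v = \<lparr>carrier = {x. val_ge v x 0}, mult = (*), one = 1,
     zero = 0, add = (+)\<rparr>"

definition place_norm :: "('a :: number_field \<Rightarrow> int) \<Rightarrow> nat" where
  "place_norm v = card (carrier (valuation_ring v Quot {x. val_ge v x 1}))"


subsection \<open>Completions\<close>

definition cauchy_ring :: "('a :: number_field \<Rightarrow> int) \<Rightarrow> (nat \<Rightarrow> 'a) ring" where
  "cauchy_ring v = \<lparr>carrier = {s. \<forall>k. \<exists>l. \<forall>m\<ge>l. \<forall>n\<ge>l. val_ge v (s m - s n) k},
     mult = (\<lambda>s t n. s n * t n), one = (\<lambda>_. 1),
     zero = (\<lambda>_. 0), add = (\<lambda>s t n. s n + t n)\<rparr>"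

definition null_sequences :: "('a :: number_field \<Rightarrow> int) \<Rightarrow> (nat \<Rightarrow> 'a) set" where
  "null_sequences v = {s. \<forall>k. \<exists>l. \<forall>n\<ge>l. val_ge v (s n) k}"

definition completion_ring :: "('a :: number_field \<Rightarrow> int) \<Rightarrow> (nat \<Rightarrow> 'a) set ring" where
  "completion_ring v = cauchy_ring v Quot null_sequences v"

definition to_completion :: "('a :: number_field \<Rightarrow> int) \<Rightarrow> 'a \<Rightarrow> (nat \<Rightarrow> 'a) set" where
  "to_completion v x = null_sequences v +>\<^bsub>cauchy_ring v\<^esub> (\<lambda>_. x)"

text \<open>For \<open>v\<close> above 2, the completion is an extension of \<open>\<rat>\<^sub>2\<close>: a 2-adic integer is the limit
  of its residues, and \<open>a / b\<close> goes to the solution \<open>y\<close> of \<open>b y = a\<close>.\<close>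

definition z2_to_completion :: "('a :: number_field \<Rightarrow> int) \<Rightarrow> z2 \<Rightarrow> (nat \<Rightarrow> 'a) set" where
  "z2_to_completion v z = null_sequences v +>\<^bsub>cauchy_ring v\<^esub> (\<lambda>n. of_int (residue z n))"

definition q2_to_completion ::
    "('a :: number_field \<Rightarrow> int) \<Rightarrow> z2 fract \<Rightarrow> (nat \<Rightarrow> 'a) set" where
  "q2_to_completion v q = (THE y. y \<in> carrier (completion_ring v) \<and>
     (\<exists>a b. b \<noteq> 0 \<and> q = Fract a b \<and>
        z2_to_completion v b \<otimes>\<^bsub>completion_ring v\<^esub> y = z2_to_completion v a))"

definition completion :: "('a :: number_field \<Rightarrow> int) \<Rightarrow> (z2 fract, (nat \<Rightarrow> 'a) set) module" where
  "completion v = ring.extend (completion_ring v)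
     (module.fields (\<lambda>q y. q2_to_completion v q \<otimes>\<^bsub>completion_ring v\<^esub> y))"

text \<open>The norm \<open>N\<^bsub>F\<^sub>v/\<rat>\<^sub>2\<^esub>\<close>: the determinant of multiplication by \<open>y\<close> in a basis, on which it does
  not depend (and \<open>1\<close> by convention without a finite basis, which does not occur).\<close>

definition ordered_basis :: "('a :: number_field \<Rightarrow> int) \<Rightarrow> (nat \<Rightarrow> 'a) set list \<Rightarrow> bool" where
  "ordered_basis v bs \<longleftrightarrow> distinct bs \<and> vectorspace.basis class_ring (completion v) (set bs)"

definition mult_matrix ::
    "('a :: number_field \<Rightarrow> int) \<Rightarrow> (nat \<Rightarrow> 'a) set list \<Rightarrow> (nat \<Rightarrow> 'a) set \<Rightarrow> z2 fract mat" where
  "mult_matrix v bs y = (THE A. A \<in> carrier_mat (length bs) (length bs) \<and>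
     (\<forall>j<length bs. y \<otimes>\<^bsub>completion v\<^esub> bs ! j =
        (\<Oplus>\<^bsub>completion v\<^esub>i\<in>{..<length bs}. (A $$ (i, j)) \<odot>\<^bsub>completion v\<^esub> bs ! i)))"

definition local_norm :: "('a :: number_field \<Rightarrow> int) \<Rightarrow> (nat \<Rightarrow> 'a) set \<Rightarrow> z2 fract" where
  "local_norm v y = (if \<exists>bs. ordered_basis v bs
     then det (mult_matrix v (SOME bs. ordered_basis v bs) y) else 1)"

definition abs2 :: "('a :: number_field \<Rightarrow> int) \<Rightarrow> 'a \<Rightarrow> z2 fract" where
  "abs2 v x = (if v 2 = 0 then of_nat (place_norm v) powi (- v x)
     else local_norm v (to_completion v x) * of_nat (place_norm v) powi (- v x))"


section \<open>Logarithmic arithmetic\<close>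

text \<open>\<open>\<R>\<^sub>F = \<int>\<^sub>2 \<otimes> F\<^sup>\<times>\<close>, written additively: the \<open>\<int>\<^sub>2\<close>-module with generators \<open>1 \<otimes> x\<close> for
  \<open>x \<in> F\<^sup>\<times>\<close> and relations \<open>1 \<otimes> x y = 1 \<otimes> x + 1 \<otimes> y\<close>.\<close>

definition tensor_relations :: "('a :: number_field \<Rightarrow> z2) set" where
  "tensor_relations = LinearCombinations.module.span class_ring (free_module (- {0}))
     {(\<lambda>z. basis_vec (x * y) z - basis_vec x z - basis_vec y z) | x y. x \<noteq> 0 \<and> y \<noteq> 0}"

definition RF :: "(z2, ('a :: number_field \<Rightarrow> z2) set) module" where
  "RF = quot_module (free_module (- {0})) tensor_relations"

definition tens :: "'a :: number_field \<Rightarrow> ('a \<Rightarrow> z2) set" where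
  "tens x = tensor_relations +>\<^bsub>free_module (- {0})\<^esub> basis_vec x"

definition linear_ext ::
    "(z2, 'm) module \<Rightarrow> ('a :: number_field \<Rightarrow> 'm) \<Rightarrow> ('a \<Rightarrow> z2) set \<Rightarrow> 'm" where
  "linear_ext M f \<alpha> = (THE y. \<exists>g \<in> LinearCombinations.module_hom class_ring RF M.
     (\<forall>x. x \<noteq> 0 \<longrightarrow> g (tens x) = f x) \<and> y = g \<alpha>)"

definition log_abs :: "('a :: number_field \<Rightarrow> int) \<Rightarrow> ('a \<Rightarrow> z2) set \<Rightarrow> z2 fract" where
  "log_abs v = linear_ext q2_module (\<lambda>x. Log2 (abs2 v x))"

text \<open>The degree of each place is a fixed but arbitrary generator of \<open>Log |\<R>\<^sub>F|\<^sub>v\<close>. The choice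
  \<open>deg\<close> is a parameter of the notions below.\<close>

definition degree_choice :: "(('a :: number_field \<Rightarrow> int) \<Rightarrow> z2) \<Rightarrow> bool" where
  "degree_choice deg \<longleftrightarrow> (\<forall>v\<in>finite_places.
     log_abs v ` carrier RF = {to_fract (c * deg v) | c. True})"

definition log_val ::
    "(('a :: number_field \<Rightarrow> int) \<Rightarrow> z2) \<Rightarrow> ('a \<Rightarrow> int) \<Rightarrow> ('a \<Rightarrow> z2) set \<Rightarrow> z2" where
  "log_val deg v \<alpha> = (THE c. to_fract c = - log_abs v \<alpha> / to_fract (deg v))"

definition Dl :: "(z2, ('a :: number_field \<Rightarrow> int) \<Rightarrow> z2) module" where
  "Dl = free_module finite_places"

definition div_deg ::
    "(('a :: number_field \<Rightarrow> int) \<Rightarrow> z2) \<Rightarrow> (('a \<Rightarrow> int) \<Rightarrow> z2) \<Rightarrow> z2" where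
  "div_deg deg d = (\<Sum>v | d v \<noteq> 0. d v * deg v)"

definition Dl0 ::
    "(('a :: number_field \<Rightarrow> int) \<Rightarrow> z2) \<Rightarrow> (z2, ('a \<Rightarrow> int) \<Rightarrow> z2) module" where
  "Dl0 deg = Dl\<lparr>carrier := {d \<in> carrier Dl. div_deg deg d = 0}\<rparr>"

definition log_div ::
    "(('a :: number_field \<Rightarrow> int) \<Rightarrow> z2) \<Rightarrow> ('a \<Rightarrow> z2) set \<Rightarrow> ('a \<Rightarrow> int) \<Rightarrow> z2" where
  "log_div deg \<alpha> = (\<lambda>v. if v \<in> finite_places then log_val deg v \<alpha> else 0)"

definition Pl :: "(('a :: number_field \<Rightarrow> int) \<Rightarrow> z2) \<Rightarrow> (('a \<Rightarrow> int) \<Rightarrow> z2) set" where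
  "Pl deg = log_div deg ` carrier RF"

definition Cl ::
    "(('a :: number_field \<Rightarrow> int) \<Rightarrow> z2) \<Rightarrow> (z2, (('a \<Rightarrow> int) \<Rightarrow> z2) set) module" where
  "Cl deg = quot_module (Dl0 deg) (Pl deg)"

definition Cl_class ::
    "(('a :: number_field \<Rightarrow> int) \<Rightarrow> z2) \<Rightarrow> (('a \<Rightarrow> int) \<Rightarrow> z2) \<Rightarrow> (('a \<Rightarrow> int) \<Rightarrow> z2) set" where
  "Cl_class deg d = Pl deg +>\<^bsub>Dl0 deg\<^esub> d"

definition log_units :: "(('a :: number_field \<Rightarrow> int) \<Rightarrow> z2) \<Rightarrow> ('a \<Rightarrow> z2) set set" where
  "log_units deg = {\<alpha> \<in> carrier RF. \<forall>v\<in>finite_places. log_val deg v \<alpha> = 0}"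

text \<open>In the following, \<open>\<sigma> 0, \<dots>, \<sigma> (r - 1)\<close> enumerates the real places.\<close>

definition sign_inf ::
    "nat \<Rightarrow> (nat \<Rightarrow> 'a :: number_field \<Rightarrow> real) \<Rightarrow> ('a \<Rightarrow> z2) set \<Rightarrow> nat \<Rightarrow> int" where
  "sign_inf r \<sigma> = linear_ext (sign_module r) (\<lambda>x. \<lambda>i\<in>{..<r}. if 0 < \<sigma> i x then 1 else - 1)"

definition Dl_res :: "(('a :: number_field \<Rightarrow> int) \<Rightarrow> z2) \<Rightarrow> nat \<Rightarrow>
    (z2, (('a \<Rightarrow> int) \<Rightarrow> z2) \<times> (nat \<Rightarrow> int)) module" where
  "Dl_res deg r = SumSpaces.direct_sum (Dl0 deg) (sign_module r)"

definition Pl_res :: "(('a :: number_field \<Rightarrow> int) \<Rightarrow> z2) \<Rightarrow> nat \<Rightarrow> (nat \<Rightarrow> 'a \<Rightarrow> real) \<Rightarrow>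
    ((('a \<Rightarrow> int) \<Rightarrow> z2) \<times> (nat \<Rightarrow> int)) set" where
  "Pl_res deg r \<sigma> = {(log_div deg \<alpha>, sign_inf r \<sigma> \<alpha>) | \<alpha>. \<alpha> \<in> carrier RF}"

definition Cl_res :: "(('a :: number_field \<Rightarrow> int) \<Rightarrow> z2) \<Rightarrow> nat \<Rightarrow> (nat \<Rightarrow> 'a \<Rightarrow> real) \<Rightarrow>
    (z2, ((('a \<Rightarrow> int) \<Rightarrow> z2) \<times> (nat \<Rightarrow> int)) set) module" where
  "Cl_res deg r \<sigma> = quot_module (Dl_res deg r) (Pl_res deg r \<sigma>)"

definition Cl_res_class :: "(('a :: number_field \<Rightarrow> int) \<Rightarrow> z2) \<Rightarrow> nat \<Rightarrow> (nat \<Rightarrow> 'a \<Rightarrow> real) \<Rightarrow>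
    (('a \<Rightarrow> int) \<Rightarrow> z2) \<times> (nat \<Rightarrow> int) \<Rightarrow> ((('a \<Rightarrow> int) \<Rightarrow> z2) \<times> (nat \<Rightarrow> int)) set" where
  "Cl_res_class deg r \<sigma> d = Pl_res deg r \<sigma> +>\<^bsub>Dl_res deg r\<^esub> d"

definition res_generators :: "(('a :: number_field \<Rightarrow> int) \<Rightarrow> z2) \<Rightarrow> nat \<Rightarrow> (nat \<Rightarrow> 'a \<Rightarrow> real) \<Rightarrow>
    nat \<Rightarrow> (nat \<Rightarrow> ('a \<Rightarrow> int) \<Rightarrow> z2) \<Rightarrow> nat \<Rightarrow> ((('a \<Rightarrow> int) \<Rightarrow> z2) \<times> (nat \<Rightarrow> int)) set" where
  "res_generators deg r \<sigma> \<nu> \<aa> k =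
     (if k < \<nu> then Cl_res_class deg r \<sigma> (\<aa> k, \<lambda>i\<in>{..<r}. 1)
      else Cl_res_class deg r \<sigma> (\<lambda>_. 0, sign_basis r (k - \<nu>)))"

text \<open>Rows and columns are indexed from \<open>0\<close>. The entry \<open>c i j\<close> stands for \<open>c\<^bsub>\<nu>+i,j\<^esub>\<close>; the
  last block has the columns \<open>2 I\<close>, \<open>(b\<^bsub>i,k\<^esub>)\<close> and \<open>(1,\<dots>,1)\<close>.\<close>

definition relation_matrix :: "nat \<Rightarrow> nat \<Rightarrow> nat \<Rightarrow> (nat \<Rightarrow> nat) \<Rightarrow> (nat \<Rightarrow> nat \<Rightarrow> nat) \<Rightarrow>
    (nat \<Rightarrow> nat \<Rightarrow> nat) \<Rightarrow> z2 mat" where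
  "relation_matrix \<nu> r s n c b =
     four_block_mat
       (mat_diag \<nu> (\<lambda>j. 2 ^ n j))
       (0\<^sub>m \<nu> (r + s + 1))
       (mat r \<nu> (\<lambda>(i, j). of_nat (c i j)))
       (mat r (r + s + 1) (\<lambda>(i, j).
          if j < r then (if i = j then 2 else 0)
          else if j < r + s then of_nat (b i (j - r))
          else 1))"

end

theory Submission
  imports Defs
begin

text \<open>A relation between the generators is a vector \<open>(x, y)\<close> for which the pair
  \<open>(\<Sum>\<^sub>j x\<^sub>j \<aa>\<^sub>j, ((-1)\<^bsup>y\<^sub>i\<^esup>)\<^sub>i)\<close> is principal in the narrow sense: there is \<open>\<beta> \<in> \<R>\<^sub>F\<close> with this
  divisor and these signs. The class of \<open>\<Sum>\<^sub>j x\<^sub>j \<aa>\<^sub>j\<close> is then trivial, so \<open>x\<^sub>j = 2\<^bsup>n\<^sub>j\<^esup> t\<^sub>j\<close>, and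
  \<open>\<beta> / \<Prod>\<^sub>j \<alpha>\<^sub>j\<^bsup>t\<^sub>j\<^esup>\<close> has divisor 0. It is a logarithmic unit, hence a product of \<open>\<plusminus>1\<close> and powers of
  the \<open>\<epsilon>\<^sub>k\<close>. Reading off signs determines \<open>y\<close> modulo 2 as a combination of the columns
  \<open>c\<close>, \<open>b\<close> and \<open>(1, \<dots>, 1)\<close>; the columns \<open>2 I\<close> account for the rest. Conversely every
  combination of columns is realized by the corresponding product of the \<open>\<alpha>\<^sub>j\<close>, \<open>\<epsilon>\<^sub>k\<close> and \<open>\<plusminus>1\<close>.
  That the listed classes generate holds because a divisor differs from some \<open>\<Sum>\<^sub>j m\<^sub>j \<aa>\<^sub>j\<close> by a
  principal one, at the cost of a change of signs.

  Three points carry this argument. The maps \<open>log_div\<close> and \<open>sign_inf\<close> are linear over \<open>\<int>\<^sub>2\<close>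
  (\<open>log_div_hom\<close>, \<open>sign_inf_hom\<close>); for signs this is the universal property of \<open>\<int>\<^sub>2 \<otimes> F\<^sup>\<times>\<close>
  (\<open>RF_lift\<close>), for divisors it comes from the existence of degrees (\<open>log_abs_linear\<close>). The
  isomorphism that describes the class group is one of groups, and \<open>\<int>\<^sub>2 / 2\<^sup>n = \<int> / 2\<^sup>n\<close>
  (\<open>z2_division\<close>) reduces coefficients in \<open>\<int>\<^sub>2\<close> to natural ones, which it controls
  (\<open>class_group_generated\<close>, \<open>class_group_independent\<close>). Finally, all divisors are regarded inside the
  module of all \<open>\<int>\<^sub>2\<close>-valued functions on the places, where classes are cosets of a submodule and
  finite sums are sums of functions.\<close>

section \<open>Residues and parity in \<open>\<int>\<^sub>2\<close>\<close>

lemma residue_of_nat: "residue (of_nat m) k = int m mod 2 ^ k"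
  by (induction m) (simp_all add: zero_z2.rep_eq plus_z2.rep_eq one_z2.rep_eq mod_simps)

text \<open>The quotient has the residues of \<open>w\<close> modulo \<open>2\<^bsup>n+k\<^esup>\<close>, divided by \<open>2\<^sup>n\<close>.\<close>

lemma pow2_dvd_z2I:
  assumes "residue w n = 0"
  shows "2 ^ n dvd w"
proof -
  define f where "f k = residue w (n + k) div 2 ^ n" for k
  have dvd: "2 ^ n dvd residue w (n + k)" for k
    using residue_add_mod[of w n k] assms by auto
  have f: "2 ^ n * f k = residue w (n + k)" for k
    using dvd[of k] by (simp add: f_def)
  have rng: "0 \<le> residue w k" "residue w k < 2 ^ k" for k
    using residue[of w] by auto
  have "f \<in> {f. \<forall>n. 0 \<le> f n \<and> f n < 2 ^ n \<and> f (Suc n) mod 2 ^ n = f n}"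
  proof (intro CollectI allI conjI)
    fix k
    show "0 \<le> f k" using rng(1)[of "n + k"] by (simp add: f_def pos_imp_zdiv_nonneg_iff)
    have "2 ^ n * f k < 2 ^ n * 2 ^ k" using rng(2)[of "n + k"] by (simp add: f power_add)
    then show "f k < 2 ^ k" by simp
    have "2 ^ n * (f (Suc k) mod 2 ^ k) = (2 ^ n * f (Suc k)) mod (2 ^ n * 2 ^ k)"
      by simp
    also have "\<dots> = residue w (Suc (n + k)) mod 2 ^ (n + k)"
      by (simp add: f power_add)
    also have "\<dots> = 2 ^ n * f k" by (simp add: residue_Suc f)
    finally show "f (Suc k) mod 2 ^ k = f k" by simp
  qed
  then have r: "residue (Abs_z2 f) = f" by (rule Abs_z2_inverse)
  have "residue (2 ^ n * Abs_z2 f) k = residue w k" for k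
  proof -
    have "residue (2 ^ n * Abs_z2 f) k = (int (2 ^ n) mod 2 ^ k * f k) mod 2 ^ k"
      using residue_of_nat[of "2 ^ n" k] by (simp add: times_z2.rep_eq r)
    also have "\<dots> = residue w (n + k) mod 2 ^ k"
      by (simp add: mod_mult_left_eq f)
    also have "\<dots> = residue w k" using residue_add_mod[of w k n] by (simp add: add.commute)
    finally show ?thesis .
  qed
  then have "2 ^ n * Abs_z2 f = w" by (simp add: residue_inject[symmetric] fun_eq_iff)
  then show ?thesis by (metis dvd_triv_left)
qed

text \<open>Since \<open>\<int>\<^sub>2/2\<^sup>n = \<int>/2\<^sup>n\<close>, a group isomorphism onto the class group controls relations with
  coefficients in \<open>\<int>\<^sub>2\<close>.\<close>

lemma z2_division:
  obtains m :: nat and t :: z2 where "m < 2 ^ n" "x = of_nat m + 2 ^ n * t"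
proof -
  define m where "m = nat (residue x n)"
  have m: "int m = residue x n" using residue[of x] by (simp add: m_def)
  have "residue x n < 2 ^ n" using residue[of x] by auto
  then have "m < 2 ^ n" using m by (metis of_nat_less_iff of_nat_numeral of_nat_power)
  moreover have "residue (x - of_nat m) n = 0"
    by (simp add: minus_z2.rep_eq residue_of_nat m)
  then have "2 ^ n dvd x - of_nat m" by (rule pow2_dvd_z2I)
  then obtain t where "x - of_nat m = 2 ^ n * t" ..
  ultimately show thesis using that by (metis add.commute diff_add_cancel)
qed

lemma even_z2_iff: "2 dvd (x :: z2) \<longleftrightarrow> even (residue x 1)"
proof
  assume "2 dvd x"
  then obtain t where "x = 2 * t" ..
  moreover have "residue (2 :: z2) 1 = 0" using residue_of_nat[of 2 1] by simp
  ultimately show "even (residue x 1)" by (simp add: times_z2.rep_eq)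
next
  assume "even (residue x 1)"
  moreover have "0 \<le> residue x 1" "residue x 1 < 2" using residue[of x] by (auto dest: spec[of _ 1])
  ultimately have "residue x 1 = 0" by presburger
  then show "2 dvd x" using pow2_dvd_z2I[of x 1] by simp
qed

lemma even_z2_mult_iff: "2 dvd (x * y :: z2) \<longleftrightarrow> 2 dvd x \<or> 2 dvd y"
  by (simp add: even_z2_iff times_z2.rep_eq even_iff_mod_2_eq_zero mod_simps)
     (simp add: even_iff_mod_2_eq_zero[symmetric])

text \<open>The character \<open>x \<mapsto> (-1)\<^sup>x\<close> of the additive group \<open>\<int>\<^sub>2\<close>.\<close>

definition parity_sign :: "z2 \<Rightarrow> int" where
  "parity_sign x = (if 2 dvd x then 1 else - 1)"

lemma parity_sign_0 [simp]: "parity_sign 0 = 1"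
  by (simp add: parity_sign_def)

lemma parity_sign_add: "parity_sign (x + y) = parity_sign x * parity_sign y"
  by (simp add: parity_sign_def even_z2_iff plus_z2.rep_eq even_iff_mod_2_eq_zero mod_simps)
     presburger

lemma even_z2_add_iff: "2 dvd (x + y :: z2) \<longleftrightarrow> (2 dvd x \<longleftrightarrow> 2 dvd y)"
  using parity_sign_add[of x y] by (simp add: parity_sign_def split: if_splits)

lemma parity_sign_sum: "parity_sign (sum f A) = (\<Prod>x\<in>A. parity_sign (f x))"
  by (induction A rule: infinite_finite_induct) (simp_all add: parity_sign_add)

lemma parity_sign_mult: "parity_sign (x * y) = (if 2 dvd x then 1 else parity_sign y)"
  by (simp add: parity_sign_def even_z2_mult_iff)

lemma parity_sign_of_nat: "parity_sign (of_nat k) = (- 1) ^ k"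
  by (simp add: parity_sign_def even_z2_iff residue_of_nat)

lemma parity_sign_1 [simp]: "parity_sign 1 = - 1"
  using parity_sign_of_nat[of 1] by simp

lemma parity_sign_eqD:
  assumes "parity_sign x = parity_sign y"
  obtains w where "x = y + 2 * w"
proof -
  have "parity_sign (x + y) = 1"
    using assms by (simp add: parity_sign_add) (simp add: parity_sign_def)
  then have "2 dvd x + y" by (auto simp: parity_sign_def split: if_splits)
  then obtain t where "x + y = 2 * t" ..
  then have "x = y + 2 * (t - y)" by (simp add: algebra_simps)
  then show thesis by (rule that)
qed

section \<open>Modules\<close>

lemma (in Module.module) submodule_carrier: "LinearCombinations.submodule R (carrier M) M"
  by (simp add: LinearCombinations.submodule_def module_axioms)

lemma module_hom_cong:
  assumes "g \<in> LinearCombinations.module_hom R M N" "Module.module R M"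
    and "\<And>x. x \<in> carrier M \<Longrightarrow> h x = g x"
  shows "h \<in> LinearCombinations.module_hom R M N"
proof -
  interpret Module.module R M by fact
  show ?thesis using assms(1,3) by (auto simp: LinearCombinations.module_hom_def Pi_iff)
qed

lemma (in Module.module) finsum_in_submodule:
  assumes "submodule R N M" "f \<in> A \<rightarrow> N"
  shows "(\<Oplus>\<^bsub>M\<^esub>i\<in>A. f i) \<in> N"
  using assms(2)
proof (induction A rule: infinite_finite_induct)
  case (insert x A)
  have "N \<subseteq> carrier M" using assms(1) by (auto simp: submodule_def)
  then show ?case using insert assms(1) by (subst finsum_insert) (auto simp: submodule_def Pi_iff)
qed (use assms(1) in \<open>auto simp: submodule_def\<close>)

lemma (in mod_hom) hom_finsum:
  assumes "g \<in> A \<rightarrow> carrier M"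
  shows "f (\<Oplus>\<^bsub>M\<^esub>i\<in>A. g i) = (\<Oplus>\<^bsub>N\<^esub>i\<in>A. f (g i))"
  using assms
proof (induction A rule: infinite_finite_induct)
  case (insert a A)
  then have "f (\<Oplus>\<^bsub>M\<^esub>i\<in>insert a A. g i) = f (g a \<oplus>\<^bsub>M\<^esub> (\<Oplus>\<^bsub>M\<^esub>i\<in>A. g i))"
    by (subst M.M.finsum_insert) auto
  also have "\<dots> = f (g a) \<oplus>\<^bsub>N\<^esub> (\<Oplus>\<^bsub>N\<^esub>i\<in>A. f (g i))" using insert by auto
  also have "\<dots> = (\<Oplus>\<^bsub>N\<^esub>i\<in>insert a A. f (g i))"
    using insert by (intro N.M.finsum_insert[symmetric]) auto
  finally show ?case .
qed auto

lemma finsum_submodule: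
  assumes D: "LinearCombinations.submodule R D M" and f: "f \<in> A \<rightarrow> D"
  shows "(\<Oplus>\<^bsub>M\<lparr>carrier := D\<rparr>\<^esub>i\<in>A. f i) = (\<Oplus>\<^bsub>M\<^esub>i\<in>A. f i)"
proof -
  interpret D: LinearCombinations.submodule R D M by (rule D)
  interpret M: Module.module R M by (rule D.module)
  have "mod_hom R (M\<lparr>carrier := D\<rparr>) M (\<lambda>x. x)"
    using D.subset M.submodule_is_module[OF D] M.module_axioms
    by (auto simp: mod_hom_def mod_hom_axioms_def LinearCombinations.module_hom_def)
  from mod_hom.hom_finsum[OF this, of f A] show ?thesis using f by simp
qed

lemma submodule_direct_sum:
  assumes "LinearCombinations.submodule R D M" "LinearCombinations.submodule R E N"
  shows "LinearCombinations.submodule R (D \<times> E) (direct_sum M N)"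
  using assms direct_sum_is_module[of R M N]
  by (auto simp: LinearCombinations.submodule_def direct_sum_def)

lemma finsum_direct_sum:
  assumes M: "Module.module R M" and N: "Module.module R N"
    and f: "f \<in> A \<rightarrow> carrier M" and g: "g \<in> A \<rightarrow> carrier N"
  shows "(\<Oplus>\<^bsub>direct_sum M N\<^esub>i\<in>A. (f i, g i)) = (\<Oplus>\<^bsub>M\<^esub>i\<in>A. f i, \<Oplus>\<^bsub>N\<^esub>i\<in>A. g i)"
proof -
  interpret M: Module.module R M by (rule M)
  interpret N: Module.module R N by (rule N)
  interpret MN: Module.module R "direct_sum M N" by (rule direct_sum_is_module[OF M N])
  have zero: "\<zero>\<^bsub>direct_sum M N\<^esub> = (\<zero>\<^bsub>M\<^esub>, \<zero>\<^bsub>N\<^esub>)" by (simp add: direct_sum_def)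
  show ?thesis using f g
  proof (induction A rule: infinite_finite_induct)
    case (insert a A)
    then have "(\<Oplus>\<^bsub>direct_sum M N\<^esub>i\<in>insert a A. (f i, g i)) =
        (f a, g a) \<oplus>\<^bsub>direct_sum M N\<^esub> (\<Oplus>\<^bsub>direct_sum M N\<^esub>i\<in>A. (f i, g i))"
      by (intro MN.finsum_insert) (auto simp: direct_sum_def)
    also have "\<dots> = (f a \<oplus>\<^bsub>M\<^esub> (\<Oplus>\<^bsub>M\<^esub>i\<in>A. f i), g a \<oplus>\<^bsub>N\<^esub> (\<Oplus>\<^bsub>N\<^esub>i\<in>A. g i))"
      using insert by (simp add: direct_sum_def)
    also have "\<dots> = (\<Oplus>\<^bsub>M\<^esub>i\<in>insert a A. f i, \<Oplus>\<^bsub>N\<^esub>i\<in>insert a A. g i)"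
      using insert M.M.finsum_insert[of A a f] N.M.finsum_insert[of A a g] by simp
    finally show ?case .
  qed (simp_all add: zero)
qed

text \<open>The generators are indexed because the \<open>\<epsilon>\<^sub>k\<close>, the classes of the generators and the columns of the
  matrix may have repetitions.\<close>

lemma (in Module.module) span_image:
  assumes I: "finite I" and f: "f \<in> I \<rightarrow> carrier M"
  shows "span (f ` I) = {\<Oplus>\<^bsub>M\<^esub>i\<in>I. z i \<odot>\<^bsub>M\<^esub> f i | z. z \<in> I \<rightarrow> carrier R}" (is "_ = ?N")
proof
  have fI: "f ` I \<subseteq> carrier M" using f by auto
  have N: "submodule R ?N M"
  proof
    show "?N \<subseteq> carrier M" using f by (auto intro!: finsum_closed)
    show "v \<oplus>\<^bsub>M\<^esub> w \<in> ?N" if vw: "v \<in> ?N" "w \<in> ?N" for v w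
    proof -
      from vw obtain y z where yz: "y \<in> I \<rightarrow> carrier R" "z \<in> I \<rightarrow> carrier R"
        "v = (\<Oplus>\<^bsub>M\<^esub>i\<in>I. y i \<odot>\<^bsub>M\<^esub> f i)" "w = (\<Oplus>\<^bsub>M\<^esub>i\<in>I. z i \<odot>\<^bsub>M\<^esub> f i)" by blast
      have "v \<oplus>\<^bsub>M\<^esub> w = (\<Oplus>\<^bsub>M\<^esub>i\<in>I. y i \<odot>\<^bsub>M\<^esub> f i \<oplus>\<^bsub>M\<^esub> z i \<odot>\<^bsub>M\<^esub> f i)"
        unfolding yz(3,4) using yz(1,2) f by (intro finsum_addf[symmetric]) auto
      also have "\<dots> = (\<Oplus>\<^bsub>M\<^esub>i\<in>I. (y i \<oplus> z i) \<odot>\<^bsub>M\<^esub> f i)"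
        using yz(1,2) f by (intro finsum_cong') (auto simp: smult_l_distr Pi_iff)
      finally show ?thesis using yz(1,2) by (intro CollectI exI[of _ "\<lambda>i. y i \<oplus> z i"]) auto
    qed
    have "(\<Oplus>\<^bsub>M\<^esub>i\<in>I. \<zero> \<odot>\<^bsub>M\<^esub> f i) = (\<Oplus>\<^bsub>M\<^esub>i\<in>I. \<zero>\<^bsub>M\<^esub>)"
      using f by (intro finsum_cong') (auto simp: Pi_iff)
    then show "\<zero>\<^bsub>M\<^esub> \<in> ?N" by (intro CollectI exI[of _ "\<lambda>_. \<zero>"]) auto
    show "c \<odot>\<^bsub>M\<^esub> v \<in> ?N" if c: "c \<in> carrier R" and v: "v \<in> ?N" for c v
    proof -
      from v obtain y where y: "y \<in> I \<rightarrow> carrier R" "v = (\<Oplus>\<^bsub>M\<^esub>i\<in>I. y i \<odot>\<^bsub>M\<^esub> f i)" by blast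
      have "c \<odot>\<^bsub>M\<^esub> v = (\<Oplus>\<^bsub>M\<^esub>i\<in>I. c \<odot>\<^bsub>M\<^esub> (y i \<odot>\<^bsub>M\<^esub> f i))"
        unfolding y(2) using y(1) f c by (intro finsum_smult) auto
      also have "\<dots> = (\<Oplus>\<^bsub>M\<^esub>i\<in>I. (c \<otimes> y i) \<odot>\<^bsub>M\<^esub> f i)"
        using y(1) f c by (intro finsum_cong') (auto simp: smult_assoc1 Pi_iff)
      finally show ?thesis using y(1) c by (intro CollectI exI[of _ "\<lambda>i. c \<otimes> y i"]) auto
    qed
  qed
  have "f ` I \<subseteq> ?N"
  proof (rule image_subsetI)
    fix i assume i: "i \<in> I"
    have "(\<Oplus>\<^bsub>M\<^esub>j\<in>I. (if j = i then \<one> else \<zero>) \<odot>\<^bsub>M\<^esub> f j) =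
        (\<Oplus>\<^bsub>M\<^esub>j\<in>I. if i = j then f j else \<zero>\<^bsub>M\<^esub>)"
      using f by (intro finsum_cong') (auto simp: Pi_iff)
    also have "\<dots> = f i" using f I i by (intro finsum_singleton) auto
    finally show "f i \<in> ?N" by (intro CollectI exI[of _ "\<lambda>j. if j = i then \<one> else \<zero>"]) auto
  qed
  then show "span (f ` I) \<subseteq> ?N" using N by (rule span_is_subset)
  have S: "submodule R (span (f ` I)) M" using fI by (rule span_is_submodule)
  then show "?N \<subseteq> span (f ` I)"
    using in_own_span[OF fI]
    by (auto intro!: finsum_in_submodule[OF S] simp: submodule_def Pi_iff)
qed

section \<open>Quotient modules\<close>

lemma quot_carrier: "carrier (quot_module M N) = (\<lambda>d. N +>\<^bsub>M\<^esub> d) ` carrier M"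
  by (auto simp: quot_module_def A_RCOSETS_def')

lemma module_surj_image:
  assumes "Module.module R P"
    and carr: "carrier Q = f ` carrier P"
    and zero: "f \<zero>\<^bsub>P\<^esub> = \<zero>\<^bsub>Q\<^esub>"
    and add: "\<And>x y. x \<in> carrier P \<Longrightarrow> y \<in> carrier P \<Longrightarrow> f (x \<oplus>\<^bsub>P\<^esub> y) = f x \<oplus>\<^bsub>Q\<^esub> f y"
    and smult: "\<And>c x. c \<in> carrier R \<Longrightarrow> x \<in> carrier P \<Longrightarrow> f (c \<odot>\<^bsub>P\<^esub> x) = c \<odot>\<^bsub>Q\<^esub> f x"
  shows "Module.module R Q"
proof -
  interpret P: Module.module R P by fact
  note simps = carr add[symmetric] smult[symmetric] zero[symmetric]
  show ?thesis
  proof (rule module_criteria)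
    show "\<forall>v\<in>carrier Q. \<exists>w\<in>carrier Q. v \<oplus>\<^bsub>Q\<^esub> w = \<zero>\<^bsub>Q\<^esub>"
    proof
      fix v assume "v \<in> carrier Q"
      then obtain x where x: "x \<in> carrier P" "v = f x" by (auto simp: carr)
      then have "v \<oplus>\<^bsub>Q\<^esub> f (\<ominus>\<^bsub>P\<^esub> x) = f (x \<oplus>\<^bsub>P\<^esub> \<ominus>\<^bsub>P\<^esub> x)" by (simp add: add)
      also have "\<dots> = \<zero>\<^bsub>Q\<^esub>" using x by (simp add: P.r_neg zero)
      finally show "\<exists>w\<in>carrier Q. v \<oplus>\<^bsub>Q\<^esub> w = \<zero>\<^bsub>Q\<^esub>" using x by (auto simp: carr)
    qed
    show "\<forall>v w. v \<in> carrier Q \<and> w \<in> carrier Q \<longrightarrow> v \<oplus>\<^bsub>Q\<^esub> w = w \<oplus>\<^bsub>Q\<^esub> v"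
      by (auto simp: simps P.a_comm)
    show "\<forall>v w x. v \<in> carrier Q \<and> w \<in> carrier Q \<and> x \<in> carrier Q \<longrightarrow>
        v \<oplus>\<^bsub>Q\<^esub> w \<oplus>\<^bsub>Q\<^esub> x = v \<oplus>\<^bsub>Q\<^esub> (w \<oplus>\<^bsub>Q\<^esub> x)"
      by (auto simp: simps P.a_assoc)
    show "\<forall>a b v. a \<in> carrier R \<and> b \<in> carrier R \<and> v \<in> carrier Q \<longrightarrow>
        (a \<otimes>\<^bsub>R\<^esub> b) \<odot>\<^bsub>Q\<^esub> v = a \<odot>\<^bsub>Q\<^esub> (b \<odot>\<^bsub>Q\<^esub> v)"
      by (auto simp: simps P.smult_assoc1)
    show "\<forall>a b v. a \<in> carrier R \<and> b \<in> carrier R \<and> v \<in> carrier Q \<longrightarrow>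
        (a \<oplus>\<^bsub>R\<^esub> b) \<odot>\<^bsub>Q\<^esub> v = a \<odot>\<^bsub>Q\<^esub> v \<oplus>\<^bsub>Q\<^esub> b \<odot>\<^bsub>Q\<^esub> v"
      by (auto simp: simps P.smult_l_distr)
    show "\<forall>a v w. a \<in> carrier R \<and> v \<in> carrier Q \<and> w \<in> carrier Q \<longrightarrow>
        a \<odot>\<^bsub>Q\<^esub> (v \<oplus>\<^bsub>Q\<^esub> w) = a \<odot>\<^bsub>Q\<^esub> v \<oplus>\<^bsub>Q\<^esub> a \<odot>\<^bsub>Q\<^esub> w"
      by (auto simp: simps P.smult_r_distr)
  qed (auto simp: simps P.R.is_cring)
qed

lemma submodule_imp_abelian_subgroup:
  assumes "LinearCombinations.submodule R N M"
  shows "abelian_subgroup N M"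
proof -
  interpret S: LinearCombinations.submodule R N M by fact
  interpret Module.module R M by (rule S.module)
  have neg: "\<ominus>\<^bsub>M\<^esub> v \<in> N" if "v \<in> N" for v
  proof -
    have "\<ominus>\<^bsub>M\<^esub> v = (\<ominus>\<^bsub>R\<^esub> \<one>\<^bsub>R\<^esub>) \<odot>\<^bsub>M\<^esub> v"
      using that S.subset by (intro smult_minus_1[symmetric]) auto
    then show ?thesis using that by simp
  qed
  have "subgroup N (add_monoid M)"
    using neg S.subset by (intro subgroup.intro) (auto simp: a_inv_def)
  then show ?thesis
    by (intro abelian_subgroupI3 additive_subgroup.intro abelian_group_axioms)
qed

text \<open>The submodule \<open>N\<close> may lie partly outside \<open>D\<close>; the cosets of the elements of \<open>D\<close> then form the
  module \<open>(D + N) / N\<close>.\<close>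

lemma quot_module_hom:
  fixes M :: "('c, 'm) module"
  assumes N: "LinearCombinations.submodule R N M" and D: "LinearCombinations.submodule R D M"
  defines "P \<equiv> M\<lparr>carrier := D\<rparr>"
  shows "mod_hom R P (quot_module P N) (\<lambda>d. N +>\<^bsub>P\<^esub> d)"
proof -
  interpret N: LinearCombinations.submodule R N M by fact
  interpret D: LinearCombinations.submodule R D M by fact
  interpret Module.module R M by (rule N.module)
  interpret S: abelian_subgroup N M using N by (rule submodule_imp_abelian_subgroup)
  let ?Q = "quot_module P N"
  have P_simps: "carrier P = D" "\<zero>\<^bsub>P\<^esub> = \<zero>\<^bsub>M\<^esub>" "add P = add M" "smult P = smult M"
    by (simp_all add: P_def)
  have P: "Module.module R P" unfolding P_def using D by (rule submodule_is_module)
  have coset: "N +>\<^bsub>P\<^esub> d = N +>\<^bsub>M\<^esub> d" for d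
    by (simp add: a_r_coset_def' P_simps)
  have carr: "carrier ?Q = (\<lambda>d. N +>\<^bsub>P\<^esub> d) ` carrier P" by (rule quot_carrier)
  have zero: "N +>\<^bsub>P\<^esub> \<zero>\<^bsub>P\<^esub> = \<zero>\<^bsub>?Q\<^esub>"
    using N.subset by (simp add: coset P_simps quot_module_def add.coset_mult_one)
  have add: "N +>\<^bsub>P\<^esub> (x \<oplus>\<^bsub>P\<^esub> y) = (N +>\<^bsub>P\<^esub> x) \<oplus>\<^bsub>?Q\<^esub> (N +>\<^bsub>P\<^esub> y)"
    if "x \<in> carrier P" "y \<in> carrier P" for x y
  proof -
    have "(N +>\<^bsub>M\<^esub> x) <+>\<^bsub>M\<^esub> (N +>\<^bsub>M\<^esub> y) = N +>\<^bsub>M\<^esub> (x \<oplus>\<^bsub>M\<^esub> y)"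
      using that D.subset by (intro S.a_rcos_sum) (auto simp: P_simps)
    then show ?thesis by (simp add: coset P_simps quot_module_def set_add_def')
  qed
  have smult: "N +>\<^bsub>P\<^esub> (c \<odot>\<^bsub>P\<^esub> x) = c \<odot>\<^bsub>?Q\<^esub> (N +>\<^bsub>P\<^esub> x)"
    if c: "c \<in> carrier R" and "x \<in> carrier P" for c x
  proof -
    have x: "x \<in> carrier M" using that D.subset by (auto simp: P_simps)
    \<comment> \<open>Scalar multiplication of a coset is a union over its elements; all terms are the same coset.\<close>
    have "N +>\<^bsub>M\<^esub> (c \<odot>\<^bsub>M\<^esub> (h \<oplus>\<^bsub>M\<^esub> x)) = N +>\<^bsub>M\<^esub> (c \<odot>\<^bsub>M\<^esub> x)" if h: "h \<in> N" for h
    proof -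
      have hM: "h \<in> carrier M" using h N.subset by auto
      have "N +>\<^bsub>M\<^esub> (c \<odot>\<^bsub>M\<^esub> (h \<oplus>\<^bsub>M\<^esub> x)) = (N +>\<^bsub>M\<^esub> (c \<odot>\<^bsub>M\<^esub> h)) +>\<^bsub>M\<^esub> (c \<odot>\<^bsub>M\<^esub> x)"
        using c x hM N.subset by (simp add: smult_r_distr a_coset_add_assoc)
      also have "N +>\<^bsub>M\<^esub> (c \<odot>\<^bsub>M\<^esub> h) = N"
        using c h by (intro S.a_rcos_const) auto
      finally show ?thesis .
    qed
    moreover have nonempty: "N \<noteq> {}" by (metis N.zero_closed empty_iff)
    ultimately have "(\<Union>h\<in>N. N +>\<^bsub>M\<^esub> (c \<odot>\<^bsub>M\<^esub> (h \<oplus>\<^bsub>M\<^esub> x))) = N +>\<^bsub>M\<^esub> (c \<odot>\<^bsub>M\<^esub> x)"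
      by (simp add: nonempty)
    then show ?thesis by (simp add: coset P_simps quot_module_def a_r_coset_def'[of M N x])
  qed
  have "Module.module R ?Q"
    using P carr zero add smult by (rule module_surj_image)
  then show ?thesis
    using P carr add smult by (auto simp: mod_hom_def mod_hom_axioms_def LinearCombinations.module_hom_def)
qed

lemma coset_eq_iff:
  fixes M :: "('c, 'm) module"
  assumes N: "LinearCombinations.submodule R N M" and x: "x \<in> carrier M" and y: "y \<in> carrier M"
  shows "N +>\<^bsub>M\<lparr>carrier := D\<rparr>\<^esub> x = N +>\<^bsub>M\<lparr>carrier := D\<rparr>\<^esub> y \<longleftrightarrow> x \<ominus>\<^bsub>M\<^esub> y \<in> N"
proof -
  interpret N: LinearCombinations.submodule R N M by fact
  interpret Module.module R M by (rule N.module)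
  interpret S: abelian_subgroup N M using N by (rule submodule_imp_abelian_subgroup)
  have coset: "N +>\<^bsub>M\<lparr>carrier := D\<rparr>\<^esub> d = N +>\<^bsub>M\<^esub> d" for d
    by (simp add: a_r_coset_def')
  have "N +>\<^bsub>M\<^esub> x = N +>\<^bsub>M\<^esub> y \<longleftrightarrow> x \<in> N +>\<^bsub>M\<^esub> y"
    using x y S.a_rcos_self S.a_repr_independence'[of x y] by metis
  also have "\<dots> \<longleftrightarrow> x \<ominus>\<^bsub>M\<^esub> y \<in> N"
    using x y S.a_rcos_module[of y x] by (simp add: a_minus_def)
  finally show ?thesis by (simp add: coset)
qed

lemma quot_module_factor:
  fixes F :: "('c, 'm) module"
  assumes G: "mod_hom R F M G" and N: "LinearCombinations.submodule R N F"
    and ker: "\<And>v. v \<in> N \<Longrightarrow> G v = \<zero>\<^bsub>M\<^esub>"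
  obtains g where "g \<in> LinearCombinations.module_hom R (quot_module F N) M"
    "\<And>v. v \<in> carrier F \<Longrightarrow> g (N +>\<^bsub>F\<^esub> v) = G v"
proof -
  interpret G: mod_hom R F M G by fact
  have F: "LinearCombinations.submodule R (carrier F) F"
    by (rule G.M.submodule_carrier)
  have F_eq: "F\<lparr>carrier := carrier F\<rparr> = F" by simp
  have q: "(\<lambda>v. N +>\<^bsub>F\<^esub> v) \<in> LinearCombinations.module_hom R F (quot_module F N)"
    using mod_hom.f_hom[OF quot_module_hom[OF N F]] unfolding F_eq .
  note q_add = LinearCombinations.module_hom_add[OF q] and q_smult = LinearCombinations.module_hom_smult[OF q]
  define g where "g X = G (SOME v. v \<in> carrier F \<and> X = N +>\<^bsub>F\<^esub> v)" for X
  have g: "g (N +>\<^bsub>F\<^esub> v) = G v" if v: "v \<in> carrier F" for v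
  proof -
    define w where "w = (SOME w. w \<in> carrier F \<and> N +>\<^bsub>F\<^esub> v = N +>\<^bsub>F\<^esub> w)"
    have "w \<in> carrier F \<and> N +>\<^bsub>F\<^esub> v = N +>\<^bsub>F\<^esub> w"
      unfolding w_def by (rule someI[of _ v]) (simp add: v)
    then have w: "w \<in> carrier F" "w \<ominus>\<^bsub>F\<^esub> v \<in> N"
      using coset_eq_iff[OF N, of w v "carrier F", unfolded F_eq] v by (metis)+
    have "(w \<ominus>\<^bsub>F\<^esub> v) \<oplus>\<^bsub>F\<^esub> v = w"
      using w(1) v by (simp add: G.M.M.minus_eq G.M.M.a_assoc G.M.M.l_neg)
    then have "G w = G (w \<ominus>\<^bsub>F\<^esub> v) \<oplus>\<^bsub>M\<^esub> G v"
      using w(1) v G.f_add[of "w \<ominus>\<^bsub>F\<^esub> v" v] by (simp del: G.f_minus)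
    then have "G w = G v" using w v by (simp add: ker del: G.f_minus)
    then show ?thesis by (simp add: g_def w_def)
  qed
  have "g \<in> LinearCombinations.module_hom R (quot_module F N) M"
    unfolding LinearCombinations.module_hom_def
  proof (intro CollectI conjI allI impI)
    show "g \<in> carrier (quot_module F N) \<rightarrow> carrier M"
      by (auto simp: quot_carrier g)
    fix X Y assume "X \<in> carrier (quot_module F N) \<and> Y \<in> carrier (quot_module F N)"
    then obtain v w where "v \<in> carrier F" "w \<in> carrier F" "X = N +>\<^bsub>F\<^esub> v" "Y = N +>\<^bsub>F\<^esub> w"
      by (auto simp: quot_carrier)
    then show "g (X \<oplus>\<^bsub>quot_module F N\<^esub> Y) = g X \<oplus>\<^bsub>M\<^esub> g Y"
      by (simp add: q_add[symmetric] g)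
  next
    fix c X assume "c \<in> carrier R \<and> X \<in> carrier (quot_module F N)"
    then obtain v where "c \<in> carrier R" "v \<in> carrier F" "X = N +>\<^bsub>F\<^esub> v"
      by (auto simp: quot_carrier)
    then show "g (c \<odot>\<^bsub>quot_module F N\<^esub> X) = c \<odot>\<^bsub>M\<^esub> g X"
      by (simp add: q_smult[symmetric] g)
  qed
  then show thesis using g by (rule that)
qed

section \<open>Modules of functions\<close>

text \<open>The ambient module for free modules and for divisors: the carriers of both are submodules of it, and
  finite sums in it are computed pointwise.\<close>

definition function_module :: "(z2, 'b \<Rightarrow> z2) module" where
  "function_module = (free_module UNIV)\<lparr>carrier := UNIV\<rparr>"

lemma function_module_simps [simp]:
  "carrier function_module = UNIV"
  "\<zero>\<^bsub>function_module\<^esub> = (\<lambda>_. 0)"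
  "\<phi> \<oplus>\<^bsub>function_module\<^esub> \<psi> = (\<lambda>s. \<phi> s + \<psi> s)"
  "c \<odot>\<^bsub>function_module\<^esub> \<phi> = (\<lambda>s. c * \<phi> s)"
  by (simp_all add: function_module_def free_module_def)

lemma free_module_simps [simp]:
  "carrier (free_module S) = {\<phi>. finite {s. \<phi> s \<noteq> 0} \<and> (\<forall>s. s \<notin> S \<longrightarrow> \<phi> s = 0)}"
  "\<zero>\<^bsub>free_module S\<^esub> = (\<lambda>_. 0)"
  "\<phi> \<oplus>\<^bsub>free_module S\<^esub> \<psi> = (\<lambda>s. \<phi> s + \<psi> s)"
  "c \<odot>\<^bsub>free_module S\<^esub> \<phi> = (\<lambda>s. c * \<phi> s)"
  by (simp_all add: free_module_def)

lemma free_module_eq: "(free_module S)\<lparr>carrier := C\<rparr> = function_module\<lparr>carrier := C\<rparr>"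
  by (simp add: free_module_def function_module_def)

lemma module_function_module: "Module.module class_ring function_module"
proof (rule module_criteria)
  show "\<forall>v\<in>carrier function_module. \<exists>w\<in>carrier function_module.
      v \<oplus>\<^bsub>function_module\<^esub> w = \<zero>\<^bsub>function_module\<^esub>"
    by (auto intro!: exI[of _ "\<lambda>s. - v s" for v])
qed (auto simp: algebra_simps class_cring.is_cring)

lemma a_minus_function_module [simp]: "\<phi> \<ominus>\<^bsub>function_module\<^esub> \<psi> = (\<lambda>s. \<phi> s - \<psi> s)"
proof -
  interpret Module.module "class_ring :: z2 ring" function_module by (rule module_function_module)
  have "\<ominus>\<^bsub>function_module\<^esub> \<psi> = (\<lambda>s. - \<psi> s)"
    by (rule minus_equality) auto
  then show ?thesis by (simp add: a_minus_def)
qed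

lemma finsum_function_module:
  "(\<Oplus>\<^bsub>function_module\<^esub>k\<in>A. d k) = (\<lambda>v. \<Sum>k\<in>A. d k v)"
proof -
  interpret Module.module "class_ring :: z2 ring" function_module by (rule module_function_module)
  show ?thesis
  proof (induction A rule: infinite_finite_induct)
    case (insert k A)
    then show ?case by (subst finsum_insert) auto
  qed auto
qed

lemma submodule_free_module:
  "LinearCombinations.submodule class_ring (carrier (free_module S)) function_module"
proof (rule LinearCombinations.submodule.intro)
  fix \<phi> \<psi> :: "'a \<Rightarrow> z2" and c :: z2
  show "Module.module class_ring function_module" by (rule module_function_module)
  assume "\<phi> \<in> carrier (free_module S)"
  then have \<phi>: "finite {s. \<phi> s \<noteq> 0}" "\<forall>s. s \<notin> S \<longrightarrow> \<phi> s = 0" by auto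
  have "{s. c * \<phi> s \<noteq> 0} \<subseteq> {s. \<phi> s \<noteq> 0}" by auto
  then show "c \<odot>\<^bsub>function_module\<^esub> \<phi> \<in> carrier (free_module S)"
    using \<phi> by (auto intro: finite_subset)
  assume "\<psi> \<in> carrier (free_module S)"
  then have \<psi>: "finite {s. \<psi> s \<noteq> 0}" "\<forall>s. s \<notin> S \<longrightarrow> \<psi> s = 0" by auto
  have "{s. \<phi> s + \<psi> s \<noteq> 0} \<subseteq> {s. \<phi> s \<noteq> 0} \<union> {s. \<psi> s \<noteq> 0}" by auto
  then show "\<phi> \<oplus>\<^bsub>function_module\<^esub> \<psi> \<in> carrier (free_module S)"
    using \<phi> \<psi> by (auto intro: finite_subset)
qed auto

lemma module_free_module: "Module.module class_ring (free_module S)"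
proof -
  have "free_module S = function_module\<lparr>carrier := carrier (free_module S)\<rparr>"
    unfolding free_module_eq[where S = S, symmetric] by simp
  then show ?thesis
    using LinearCombinations.module.submodule_is_module[OF module_function_module submodule_free_module] by metis
qed

lemma free_module_induct [consumes 1, case_names zero step]:
  assumes "\<phi> \<in> carrier (free_module S)"
    and zero: "P (\<lambda>_. 0)"
    and step: "\<And>\<phi> c s. \<phi> \<in> carrier (free_module S) \<Longrightarrow> s \<in> S \<Longrightarrow> P \<phi> \<Longrightarrow>
      P (\<lambda>t. \<phi> t + c * basis_vec s t)"
  shows "P \<phi>"
proof -
  have restr: "P (\<lambda>t. if t \<in> T then \<phi> t else 0)" if "finite T" "T \<subseteq> S" for T
    using that
  proof (induction T)
    case empty
    then show ?case by (simp add: zero)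
  next
    case (insert s T)
    have "{t. (if t \<in> T then \<phi> t else 0) \<noteq> 0} \<subseteq> T" by auto
    then have fin: "finite {t. (if t \<in> T then \<phi> t else 0) \<noteq> 0}"
      using insert.hyps(1) finite_subset by blast
    have "(\<lambda>t. if t \<in> insert s T then \<phi> t else 0) =
        (\<lambda>t. (if t \<in> T then \<phi> t else 0) + \<phi> s * basis_vec s t)"
      using insert.hyps(2) by (auto simp: basis_vec_def fun_eq_iff)
    moreover have "P (\<lambda>t. (if t \<in> T then \<phi> t else 0) + \<phi> s * basis_vec s t)"
      using insert fin by (intro step) auto
    ultimately show ?case by metis
  qed
  have "P (\<lambda>t. if t \<in> {t. \<phi> t \<noteq> 0} then \<phi> t else 0)"
    using assms(1) by (intro restr) auto
  moreover have "(\<lambda>t. if t \<in> {t. \<phi> t \<noteq> 0} then \<phi> t else 0) = \<phi>" by auto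
  ultimately show ?thesis by (simp only:)
qed

lemma basis_vec_in_free_module: "s \<in> S \<Longrightarrow> basis_vec s \<in> carrier (free_module S)"
  by (auto simp: basis_vec_def)

lemma free_module_lift:
  assumes "Module.module class_ring M" and f: "\<And>s. s \<in> S \<Longrightarrow> f s \<in> carrier M"
  obtains G where "mod_hom class_ring (free_module S) M G"
    "\<And>s. s \<in> S \<Longrightarrow> G (basis_vec s) = f s"
proof -
  interpret M: Module.module "class_ring :: z2 ring" M by fact
  define G where "G \<phi> = (\<Oplus>\<^bsub>M\<^esub>s\<in>{s. \<phi> s \<noteq> 0}. \<phi> s \<odot>\<^bsub>M\<^esub> f s)" for \<phi>
  have G_eq: "G \<phi> = (\<Oplus>\<^bsub>M\<^esub>s\<in>T. \<phi> s \<odot>\<^bsub>M\<^esub> f s)"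
    if "finite T" "{s. \<phi> s \<noteq> 0} \<subseteq> T" "T \<subseteq> S" for T \<phi>
    unfolding G_def using that f M.smult_l_null by (intro M.add.finprod_mono_neutral_cong_left) (auto simp: subset_iff)
  have "mod_hom class_ring (free_module S) M G"
  proof (intro mod_hom.intro mod_hom_axioms.intro module_free_module assms(1))
    show "G \<in> LinearCombinations.module_hom class_ring (free_module S) M"
      unfolding LinearCombinations.module_hom_def
    proof (intro CollectI conjI allI impI)
      show "G \<in> carrier (free_module S) \<rightarrow> carrier M"
      proof
        fix \<phi> assume "\<phi> \<in> carrier (free_module S)"
        then have "s \<in> S" if "\<phi> s \<noteq> 0" for s using that by auto
        then show "G \<phi> \<in> carrier M" unfolding G_def
          by (intro M.finsum_closed) (auto intro!: M.smult_closed f)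
      qed
      fix \<phi> \<psi> assume \<phi>\<psi>: "\<phi> \<in> carrier (free_module S) \<and> \<psi> \<in> carrier (free_module S)"
      define T where "T = {s. \<phi> s \<noteq> 0} \<union> {s. \<psi> s \<noteq> 0}"
      have T: "finite T" "T \<subseteq> S" using \<phi>\<psi> by (auto simp: T_def)
      have "G (\<lambda>s. \<phi> s + \<psi> s) = (\<Oplus>\<^bsub>M\<^esub>s\<in>T. (\<phi> s + \<psi> s) \<odot>\<^bsub>M\<^esub> f s)"
        using T by (intro G_eq) (auto simp: T_def)
      also have "\<dots> = (\<Oplus>\<^bsub>M\<^esub>s\<in>T. \<phi> s \<odot>\<^bsub>M\<^esub> f s \<oplus>\<^bsub>M\<^esub> \<psi> s \<odot>\<^bsub>M\<^esub> f s)"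
        using T f M.smult_l_distr by (intro M.finsum_cong') (auto simp: subset_iff)
      also have "\<dots> = (\<Oplus>\<^bsub>M\<^esub>s\<in>T. \<phi> s \<odot>\<^bsub>M\<^esub> f s) \<oplus>\<^bsub>M\<^esub> (\<Oplus>\<^bsub>M\<^esub>s\<in>T. \<psi> s \<odot>\<^bsub>M\<^esub> f s)"
        using T f by (intro M.finsum_addf) (auto simp: subset_iff)
      also have "\<dots> = G \<phi> \<oplus>\<^bsub>M\<^esub> G \<psi>"
        using T by (simp add: G_eq[of T] T_def)
      finally show "G (\<phi> \<oplus>\<^bsub>free_module S\<^esub> \<psi>) = G \<phi> \<oplus>\<^bsub>M\<^esub> G \<psi>" by simp
    next
      fix c :: z2 and \<phi> assume "c \<in> carrier class_ring \<and> \<phi> \<in> carrier (free_module S)"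
      then have T: "finite {s. \<phi> s \<noteq> 0}" "{s. \<phi> s \<noteq> 0} \<subseteq> S" by auto
      have "G (\<lambda>s. c * \<phi> s) = (\<Oplus>\<^bsub>M\<^esub>s\<in>{s. \<phi> s \<noteq> 0}. (c * \<phi> s) \<odot>\<^bsub>M\<^esub> f s)"
        using T by (intro G_eq) auto
      also have "\<dots> = (\<Oplus>\<^bsub>M\<^esub>s\<in>{s. \<phi> s \<noteq> 0}. c \<odot>\<^bsub>M\<^esub> (\<phi> s \<odot>\<^bsub>M\<^esub> f s))"
        using T f M.smult_assoc1 by (intro M.finsum_cong') (auto simp: subset_iff)
      also have "\<dots> = c \<odot>\<^bsub>M\<^esub> G \<phi>"
        unfolding G_def using T f by (intro M.finsum_smult[symmetric]) (auto simp: subset_iff)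
      finally show "G (c \<odot>\<^bsub>free_module S\<^esub> \<phi>) = c \<odot>\<^bsub>M\<^esub> G \<phi>" by simp
    qed
  qed
  moreover have "G (basis_vec s) = f s" if "s \<in> S" for s
  proof -
    have "G (basis_vec s) = (\<Oplus>\<^bsub>M\<^esub>t\<in>{s}. basis_vec s t \<odot>\<^bsub>M\<^esub> f t)"
      using that by (intro G_eq) (auto simp: basis_vec_def)
    also have "\<dots> = f s" using f[OF that] M.smult_one[of "f s"] by (simp add: basis_vec_def)
    finally show ?thesis .
  qed
  ultimately show thesis by (rule that)
qed

section \<open>Linear maps on \<open>\<int>\<^sub>2 \<otimes> F\<^sup>\<times>\<close>\<close>

lemma tensor_relator_closed:
  fixes x y :: "'a :: number_field"
  assumes "x \<noteq> 0" "y \<noteq> 0"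
  shows "(\<lambda>z. basis_vec (x * y) z - basis_vec x z - basis_vec y z) \<in> carrier (free_module (- {0}))"
proof -
  have "{z. basis_vec (x * y) z - basis_vec x z - basis_vec y z \<noteq> 0} \<subseteq> {x * y, x, y}"
    by (auto simp: basis_vec_def)
  then have "finite {z. basis_vec (x * y) z - basis_vec x z - basis_vec y z \<noteq> 0}"
    by (rule finite_subset) simp
  then show ?thesis using assms by (auto simp: basis_vec_def)
qed

lemma submodule_tensor_relations:
  "LinearCombinations.submodule class_ring (tensor_relations :: ('a :: number_field \<Rightarrow> z2) set)
     (free_module (- {0}))"
  unfolding tensor_relations_def
  by (rule LinearCombinations.module.span_is_submodule[OF module_free_module])
    (auto intro!: tensor_relator_closed simp del: free_module_simps)

lemma RF_quotient_hom:
  "mod_hom class_ring (free_module (- {0})) RF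
     (\<lambda>\<phi>. tensor_relations +>\<^bsub>free_module (- {0})\<^esub> (\<phi> :: 'a :: number_field \<Rightarrow> z2))"
proof -
  let ?F = "free_module (- {0 :: 'a})"
  have eq: "?F\<lparr>carrier := carrier ?F\<rparr> = ?F" by simp
  have "LinearCombinations.submodule class_ring (carrier ?F) ?F"
    using module_free_module by (rule module.submodule_carrier)
  from quot_module_hom[OF submodule_tensor_relations this] show ?thesis
    unfolding eq RF_def .
qed

lemma module_RF: "Module.module class_ring (RF :: (z2, ('a :: number_field \<Rightarrow> z2) set) module)"
  using RF_quotient_hom by (rule mod_hom.axioms(2))

lemma tens_closed: "x \<noteq> 0 \<Longrightarrow> tens x \<in> carrier RF"
  unfolding tens_def using RF_quotient_hom
  by (rule mod_hom.f_im) (rule basis_vec_in_free_module, simp)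

text \<open>The elements \<open>1 \<otimes> x\<close> generate \<open>\<R>\<^sub>F\<close>.\<close>

lemma RF_hom_eq:
  fixes \<alpha> :: "('a :: number_field \<Rightarrow> z2) set"
  assumes M: "Module.module class_ring M"
    and g: "g \<in> LinearCombinations.module_hom class_ring RF M"
    and h: "h \<in> LinearCombinations.module_hom class_ring RF M"
    and gh: "\<And>x. x \<noteq> 0 \<Longrightarrow> g (tens x) = h (tens x)" and \<alpha>: "\<alpha> \<in> carrier RF"
  shows "g \<alpha> = h \<alpha>"
proof -
  let ?F = "free_module (- {0 :: 'a})"
  let ?q = "\<lambda>\<phi> :: 'a \<Rightarrow> z2. tensor_relations +>\<^bsub>?F\<^esub> \<phi>"
  have q: "?q \<in> LinearCombinations.module_hom class_ring ?F RF"
    using RF_quotient_hom by (rule mod_hom.f_hom)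
  have g0: "mod_hom class_ring RF M g" and h0: "mod_hom class_ring RF M h"
    using M g h by (auto simp: mod_hom_def mod_hom_axioms_def module_RF)
  from \<alpha> obtain \<phi> where \<phi>: "\<phi> \<in> carrier ?F" and \<alpha>_eq: "\<alpha> = ?q \<phi>"
    unfolding RF_def quot_carrier by blast
  from \<phi> have "g (?q \<phi>) = h (?q \<phi>)"
  proof (induction rule: free_module_induct)
    case zero
    have "?q (\<lambda>_. 0) = \<zero>\<^bsub>RF\<^esub>"
      using mod_hom.f0_is_0[OF RF_quotient_hom] by simp
    then show ?case using mod_hom.f0_is_0[OF g0] mod_hom.f0_is_0[OF h0] by simp
  next
    case (step \<phi> c s)
    have s: "basis_vec s \<in> carrier ?F" using step.hyps(2) by (rule basis_vec_in_free_module)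
    then have cs: "c \<odot>\<^bsub>?F\<^esub> basis_vec s \<in> carrier ?F"
      by (intro Module.module.smult_closed[OF module_free_module]) auto
    have closed: "?q \<psi> \<in> carrier RF" if "\<psi> \<in> carrier ?F" for \<psi>
      using mod_hom.f_im[OF RF_quotient_hom that] .
    have tens: "?q (basis_vec s) = tens s" by (simp add: tens_def)
    have "?q (\<lambda>t. \<phi> t + c * basis_vec s t) = ?q (\<phi> \<oplus>\<^bsub>?F\<^esub> c \<odot>\<^bsub>?F\<^esub> basis_vec s)" by simp
    also have "\<dots> = ?q \<phi> \<oplus>\<^bsub>RF\<^esub> c \<odot>\<^bsub>RF\<^esub> tens s"
      using LinearCombinations.module_hom_add[OF q step.hyps(1) cs]
        LinearCombinations.module_hom_smult[OF q _ s, of c] tens by simp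
    finally have eq: "?q (\<lambda>t. \<phi> t + c * basis_vec s t) = ?q \<phi> \<oplus>\<^bsub>RF\<^esub> c \<odot>\<^bsub>RF\<^esub> tens s" .
    have ts: "tens s \<in> carrier RF" "c \<odot>\<^bsub>RF\<^esub> tens s \<in> carrier RF"
      using closed[OF s] Module.module.smult_closed[OF module_RF] unfolding tens by auto
    have k: "k (?q \<phi> \<oplus>\<^bsub>RF\<^esub> c \<odot>\<^bsub>RF\<^esub> tens s) = k (?q \<phi>) \<oplus>\<^bsub>M\<^esub> c \<odot>\<^bsub>M\<^esub> k (tens s)"
      if k: "k \<in> LinearCombinations.module_hom class_ring RF M" for k
      using LinearCombinations.module_hom_add[OF k closed[OF step.hyps(1)] ts(2)]
        LinearCombinations.module_hom_smult[OF k _ ts(1), of c] by simp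
    then show ?case using gh[of s] step.hyps(2) unfolding eq k[OF g] k[OF h] step.IH by simp
  qed
  then show ?thesis by (simp add: \<alpha>_eq)
qed

text \<open>The universal property of \<open>\<int>\<^sub>2 \<otimes> F\<^sup>\<times>\<close>: the linear map on the free module with values \<open>f\<close>
  on the basis descends because a multiplicative \<open>f\<close> sends the relators to 0.\<close>

lemma RF_lift:
  fixes f :: "'a :: number_field \<Rightarrow> 'm"
  assumes M: "Module.module class_ring M"
    and closed: "\<And>x. x \<noteq> 0 \<Longrightarrow> f x \<in> carrier M"
    and mult: "\<And>x y. x \<noteq> 0 \<Longrightarrow> y \<noteq> 0 \<Longrightarrow> f (x * y) = f x \<oplus>\<^bsub>M\<^esub> f y"
  obtains g where "g \<in> LinearCombinations.module_hom class_ring RF M"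
    "\<And>x. x \<noteq> 0 \<Longrightarrow> g (tens x) = f x"
proof -
  let ?F = "free_module (- {0 :: 'a})"
  obtain G where G: "mod_hom class_ring ?F M G"
    and Gf: "\<And>x. x \<noteq> 0 \<Longrightarrow> G (basis_vec x) = f x"
    using free_module_lift[OF M, of "- {0 :: 'a}" f] closed by auto
  interpret M: Module.module "class_ring :: z2 ring" M by (rule M)
  have hom: "G \<in> LinearCombinations.module_hom class_ring ?F M" using G by (rule mod_hom.f_hom)
  let ?S = "{(\<lambda>z. basis_vec (x * y) z - basis_vec x z - basis_vec y z) | x y :: 'a. x \<noteq> 0 \<and> y \<noteq> 0}"
  have "?S \<subseteq> mod_hom.ker ?F M G"
  proof safe
    fix x y :: 'a assume xy: "x \<noteq> 0" "y \<noteq> 0"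
    let ?d = "\<lambda>z. basis_vec (x * y) z - basis_vec x z - basis_vec y z"
    have d: "?d \<in> carrier ?F" using xy by (rule tensor_relator_closed)
    have bv: "basis_vec x \<in> carrier ?F" "basis_vec y \<in> carrier ?F"
      using xy by (auto intro!: basis_vec_in_free_module simp del: free_module_simps)
    have bvxy: "basis_vec x \<oplus>\<^bsub>?F\<^esub> basis_vec y \<in> carrier ?F"
      using bv Module.module.axioms(2)[OF module_free_module]
      by (intro abelian_monoid.a_closed) (auto simp: abelian_group_def)
    \<comment> \<open>Adding the two subtracted basis vectors back avoids inverses in \<open>M\<close>.\<close>
    have "?d \<oplus>\<^bsub>?F\<^esub> (basis_vec x \<oplus>\<^bsub>?F\<^esub> basis_vec y) = basis_vec (x * y)"
      by (simp add: fun_eq_iff)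
    then have "f (x * y) = G (?d \<oplus>\<^bsub>?F\<^esub> (basis_vec x \<oplus>\<^bsub>?F\<^esub> basis_vec y))"
      using Gf[of "x * y"] xy by simp
    also have "\<dots> = G ?d \<oplus>\<^bsub>M\<^esub> f (x * y)"
      unfolding LinearCombinations.module_hom_add[OF hom d bvxy]
        LinearCombinations.module_hom_add[OF hom bv] using xy mult Gf by simp
    finally have "G ?d \<oplus>\<^bsub>M\<^esub> f (x * y) = f (x * y)" ..
    moreover have "f (x * y) \<in> carrier M" "G ?d \<in> carrier M"
      using closed[of "x * y"] xy mod_hom.f_im[OF G d] by auto
    ultimately have "G ?d = \<zero>\<^bsub>M\<^esub>" by simp
    then show "?d \<in> mod_hom.ker ?F M G" using d by (simp add: mod_hom.ker_def[OF G])
  qed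
  then have "tensor_relations \<subseteq> mod_hom.ker ?F M G"
    unfolding tensor_relations_def
    by (rule LinearCombinations.module.span_is_subset[OF module_free_module _ mod_hom.ker_is_submodule[OF G]])
  then have "G v = \<zero>\<^bsub>M\<^esub>" if "v \<in> tensor_relations" for v
    using that by (auto simp: mod_hom.ker_def[OF G])
  from quot_module_factor[OF G submodule_tensor_relations this]
  obtain g where "g \<in> LinearCombinations.module_hom class_ring (quot_module ?F tensor_relations) M"
    and g: "\<And>v. v \<in> carrier ?F \<Longrightarrow> g (tensor_relations +>\<^bsub>?F\<^esub> v) = G v" by blast
  then have "g \<in> LinearCombinations.module_hom class_ring RF M" by (simp add: RF_def)
  moreover have "g (tens x) = f x" if "x \<noteq> 0" for x
    using that Gf by (simp add: tens_def g basis_vec_in_free_module del: free_module_simps)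
  ultimately show thesis by (rule that)
qed

lemma linear_ext_eq:
  assumes M: "Module.module class_ring M"
    and g: "g \<in> LinearCombinations.module_hom class_ring RF M"
    and gf: "\<And>x. x \<noteq> 0 \<Longrightarrow> g (tens x) = f x" and \<alpha>: "\<alpha> \<in> carrier RF"
  shows "linear_ext M f \<alpha> = g \<alpha>"
  unfolding linear_ext_def
proof (rule the_equality)
  show "\<exists>h\<in>LinearCombinations.module_hom class_ring RF M. (\<forall>x. x \<noteq> 0 \<longrightarrow> h (tens x) = f x) \<and> g \<alpha> = h \<alpha>"
    using g gf by blast
  fix y
  assume "\<exists>h\<in>LinearCombinations.module_hom class_ring RF M. (\<forall>x. x \<noteq> 0 \<longrightarrow> h (tens x) = f x) \<and> y = h \<alpha>"
  then show "y = g \<alpha>" using RF_hom_eq[OF M g _ _ \<alpha>] gf by metis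
qed

section \<open>Signs\<close>

lemma sign_module_simps:
  "carrier (sign_module r) = {..<r} \<rightarrow>\<^sub>E {1, - 1}"
  "\<zero>\<^bsub>sign_module r\<^esub> = (\<lambda>i\<in>{..<r}. 1)"
  "s \<oplus>\<^bsub>sign_module r\<^esub> t = (\<lambda>i\<in>{..<r}. s i * t i)"
  "c \<odot>\<^bsub>sign_module r\<^esub> s = (\<lambda>i\<in>{..<r}. if 2 dvd c then 1 else s i)"
  by (simp_all add: sign_module_def)

lemma sign_apply:
  "i < r \<Longrightarrow> \<zero>\<^bsub>sign_module r\<^esub> i = 1"
  "i < r \<Longrightarrow> (s \<oplus>\<^bsub>sign_module r\<^esub> t) i = s i * t i"
  "i < r \<Longrightarrow> (c \<odot>\<^bsub>sign_module r\<^esub> s) i = (if 2 dvd c then 1 else s i)"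
  by (simp_all add: sign_module_simps)

lemma sign_module_eqI:
  assumes "s \<in> carrier (sign_module r)" "t \<in> carrier (sign_module r)"
    and "\<And>i. i < r \<Longrightarrow> s i = t i"
  shows "s = t"
  using assms by (intro PiE_ext[of s "{..<r}" "\<lambda>_. {1, - 1}" t]) (auto simp: sign_module_simps)

lemma sign_cases:
  assumes "s \<in> carrier (sign_module r)" "i < r"
  obtains "s i = 1" | "s i = - 1"
  using assms by (auto simp: sign_module_simps PiE_iff)

lemma restrict_sign_closed:
  "(\<And>i. i < r \<Longrightarrow> f i = 1 \<or> f i = - 1) \<Longrightarrow> restrict f {..<r} \<in> carrier (sign_module r)"
  by (auto simp: sign_module_simps)

lemma module_sign_module: "Module.module class_ring (sign_module r)"
proof (rule module_criteria)
  let ?S = "sign_module r"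
  show zero: "\<zero>\<^bsub>?S\<^esub> \<in> carrier ?S" by (auto simp: sign_module_simps)
  have add: "s \<oplus>\<^bsub>?S\<^esub> t \<in> carrier ?S" if "s \<in> carrier ?S" "t \<in> carrier ?S" for s t
    unfolding sign_module_simps(3) using that by (intro restrict_sign_closed) (auto elim!: sign_cases)
  have smult: "c \<odot>\<^bsub>?S\<^esub> s \<in> carrier ?S" if "s \<in> carrier ?S" for c s
    unfolding sign_module_simps(4) using that by (intro restrict_sign_closed) (auto elim!: sign_cases)
  show "\<forall>v w. v \<in> carrier ?S \<and> w \<in> carrier ?S \<longrightarrow> v \<oplus>\<^bsub>?S\<^esub> w \<in> carrier ?S"
    using add by blast
  show "\<forall>c v. c \<in> carrier class_ring \<and> v \<in> carrier ?S \<longrightarrow> c \<odot>\<^bsub>?S\<^esub> v \<in> carrier ?S"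
    using smult by blast
  show "\<forall>v\<in>carrier ?S. \<exists>w\<in>carrier ?S. v \<oplus>\<^bsub>?S\<^esub> w = \<zero>\<^bsub>?S\<^esub>"
  proof
    fix v assume v: "v \<in> carrier ?S"
    have "v \<oplus>\<^bsub>?S\<^esub> v = \<zero>\<^bsub>?S\<^esub>"
      using v by (intro sign_module_eqI[of _ r] add zero) (auto simp: sign_module_simps(2,3) elim!: sign_cases)
    then show "\<exists>w\<in>carrier ?S. v \<oplus>\<^bsub>?S\<^esub> w = \<zero>\<^bsub>?S\<^esub>" using v by blast
  qed
  show "\<forall>v w. v \<in> carrier ?S \<and> w \<in> carrier ?S \<longrightarrow> v \<oplus>\<^bsub>?S\<^esub> w = w \<oplus>\<^bsub>?S\<^esub> v"
    by (simp add: sign_module_simps mult.commute)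
  note closed = add smult zero
  show "\<forall>v w x. v \<in> carrier ?S \<and> w \<in> carrier ?S \<and> x \<in> carrier ?S \<longrightarrow>
      v \<oplus>\<^bsub>?S\<^esub> w \<oplus>\<^bsub>?S\<^esub> x = v \<oplus>\<^bsub>?S\<^esub> (w \<oplus>\<^bsub>?S\<^esub> x)"
    by (intro allI impI, elim conjE, rule sign_module_eqI[of _ r]) (simp_all add: closed sign_apply)
  show "\<forall>v\<in>carrier ?S. v \<oplus>\<^bsub>?S\<^esub> \<zero>\<^bsub>?S\<^esub> = v"
    by (intro ballI, rule sign_module_eqI[of _ r]) (simp_all add: closed sign_apply)
  have "\<not> 2 dvd (1 :: z2)" using even_z2_iff[of 1] by (simp add: one_z2.rep_eq)
  then show "\<forall>v\<in>carrier ?S. \<one>\<^bsub>class_ring\<^esub> \<odot>\<^bsub>?S\<^esub> v = v"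
    by (intro ballI, intro sign_module_eqI[of _ r]) (simp_all add: closed sign_apply)
  show "\<forall>a b v. a \<in> carrier class_ring \<and> b \<in> carrier class_ring \<and> v \<in> carrier ?S \<longrightarrow>
      (a \<otimes>\<^bsub>class_ring\<^esub> b) \<odot>\<^bsub>?S\<^esub> v = a \<odot>\<^bsub>?S\<^esub> (b \<odot>\<^bsub>?S\<^esub> v)"
    by (intro allI impI, elim conjE, rule sign_module_eqI[of _ r])
      (simp_all add: closed sign_apply even_z2_mult_iff)
  show "\<forall>a b v. a \<in> carrier class_ring \<and> b \<in> carrier class_ring \<and> v \<in> carrier ?S \<longrightarrow>
      (a \<oplus>\<^bsub>class_ring\<^esub> b) \<odot>\<^bsub>?S\<^esub> v = a \<odot>\<^bsub>?S\<^esub> v \<oplus>\<^bsub>?S\<^esub> b \<odot>\<^bsub>?S\<^esub> v"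
    by (intro allI impI, elim conjE, rule sign_module_eqI[of _ r])
      (auto simp: closed sign_apply even_z2_add_iff elim!: sign_cases)
  show "\<forall>a v w. a \<in> carrier class_ring \<and> v \<in> carrier ?S \<and> w \<in> carrier ?S \<longrightarrow>
      a \<odot>\<^bsub>?S\<^esub> (v \<oplus>\<^bsub>?S\<^esub> w) = a \<odot>\<^bsub>?S\<^esub> v \<oplus>\<^bsub>?S\<^esub> a \<odot>\<^bsub>?S\<^esub> w"
    by (intro allI impI, elim conjE, rule sign_module_eqI[of _ r]) (simp_all add: closed sign_apply)
qed (rule class_cring.is_cring)

lemma finsum_sign_module:
  assumes "s \<in> A \<rightarrow> carrier (sign_module r)" "finite A" "i < r"
  shows "(\<Oplus>\<^bsub>sign_module r\<^esub>k\<in>A. s k) i = (\<Prod>k\<in>A. s k i)"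
proof -
  interpret Module.module "class_ring :: z2 ring" "sign_module r" by (rule module_sign_module)
  show ?thesis using assms(2,1)
  proof (induction A)
    case (insert k A)
    then have "(\<Oplus>\<^bsub>sign_module r\<^esub>k\<in>insert k A. s k) = s k \<oplus>\<^bsub>sign_module r\<^esub> (\<Oplus>\<^bsub>sign_module r\<^esub>k\<in>A. s k)"
      by (intro finsum_insert) auto
    then show ?case using insert assms(3) by (simp add: sign_module_simps(3))
  qed (use assms(3) in \<open>simp add: sign_module_simps(2)\<close>)
qed

lemma sign_inf:
  fixes \<sigma> :: "nat \<Rightarrow> 'a :: number_field \<Rightarrow> real"
  assumes \<sigma>: "\<And>i. i < r \<Longrightarrow> field_hom (\<sigma> i)"
  shows sign_inf_hom: "mod_hom class_ring RF (sign_module r) (sign_inf r \<sigma>)"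
    and sign_inf_tens: "x \<noteq> 0 \<Longrightarrow> sign_inf r \<sigma> (tens x) = (\<lambda>i\<in>{..<r}. if 0 < \<sigma> i x then 1 else - 1)"
proof -
  let ?f = "\<lambda>x. \<lambda>i\<in>{..<r}. if 0 < \<sigma> i x then 1 else (- 1 :: int)"
  have closed: "?f x \<in> carrier (sign_module r)" for x
    by (rule restrict_sign_closed) auto
  have mult: "?f (x * y) = ?f x \<oplus>\<^bsub>sign_module r\<^esub> ?f y" if "x \<noteq> 0" "y \<noteq> 0" for x y
  proof -
    have "(0 < \<sigma> i (x * y)) = (0 < \<sigma> i x \<longleftrightarrow> 0 < \<sigma> i y)" if i: "i < r" for i
    proof -
      interpret field_hom "\<sigma> i" by (rule \<sigma>[OF i])
      have "\<sigma> i x \<noteq> 0" "\<sigma> i y \<noteq> 0" using \<open>x \<noteq> 0\<close> \<open>y \<noteq> 0\<close> by auto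
      then show ?thesis by (auto simp: hom_mult zero_less_mult_iff)
    qed
    then show ?thesis by (auto simp: sign_module_simps(3) intro!: restrict_ext)
  qed
  obtain g where g: "g \<in> LinearCombinations.module_hom class_ring RF (sign_module r)"
    and gf: "\<And>x. x \<noteq> 0 \<Longrightarrow> g (tens x) = ?f x"
    using RF_lift[of "sign_module r" ?f] module_sign_module closed mult by blast
  have eq: "sign_inf r \<sigma> \<alpha> = g \<alpha>" if "\<alpha> \<in> carrier RF" for \<alpha>
    unfolding sign_inf_def using module_sign_module g gf that by (rule linear_ext_eq)
  have "sign_inf r \<sigma> \<in> LinearCombinations.module_hom class_ring RF (sign_module r)"
    using g module_RF eq by (rule module_hom_cong)
  then show "mod_hom class_ring RF (sign_module r) (sign_inf r \<sigma>)"
    by (simp add: mod_hom_def mod_hom_axioms_def module_RF module_sign_module)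
  show "x \<noteq> 0 \<Longrightarrow> sign_inf r \<sigma> (tens x) = ?f x" using eq[OF tens_closed, of x] gf[of x] by simp
qed

text \<open>With \<open>(-1)\<^sup>e\<close> for signs, the sign of a combination in \<open>\<R>\<^sub>F\<close> is that of a linear form in the
  coefficients.\<close>

lemma sign_inf_finsum:
  fixes \<sigma> :: "nat \<Rightarrow> 'a :: number_field \<Rightarrow> real"
  assumes \<sigma>: "\<And>i. i < r \<Longrightarrow> field_hom (\<sigma> i)" and f: "f \<in> I \<rightarrow> carrier RF" "finite I"
    and e: "\<And>j. j \<in> I \<Longrightarrow> sign_inf r \<sigma> (f j) i = parity_sign (e j)" and i: "i < r"
  shows "sign_inf r \<sigma> (\<Oplus>\<^bsub>RF\<^esub>j\<in>I. t j \<odot>\<^bsub>RF\<^esub> f j) i = parity_sign (\<Sum>j\<in>I. t j * e j)"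
proof -
  interpret S: mod_hom class_ring RF "sign_module r" "sign_inf r \<sigma>" using \<sigma> by (rule sign_inf_hom)
  have closed: "t j \<odot>\<^bsub>RF\<^esub> f j \<in> carrier RF" if "j \<in> I" for j
    using f(1) that by (auto intro!: S.M.smult_closed)
  have "sign_inf r \<sigma> (\<Oplus>\<^bsub>RF\<^esub>j\<in>I. t j \<odot>\<^bsub>RF\<^esub> f j) i =
      (\<Oplus>\<^bsub>sign_module r\<^esub>j\<in>I. sign_inf r \<sigma> (t j \<odot>\<^bsub>RF\<^esub> f j)) i"
    using closed by (subst S.hom_finsum) auto
  also have "\<dots> = (\<Prod>j\<in>I. sign_inf r \<sigma> (t j \<odot>\<^bsub>RF\<^esub> f j) i)"
    using closed f(2) i by (intro finsum_sign_module) auto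
  also have "\<dots> = (\<Prod>j\<in>I. parity_sign (t j * e j))"
  proof (rule prod.cong[OF refl])
    fix j assume j: "j \<in> I"
    then have "sign_inf r \<sigma> (t j \<odot>\<^bsub>RF\<^esub> f j) = t j \<odot>\<^bsub>sign_module r\<^esub> sign_inf r \<sigma> (f j)"
      using f(1) by (intro S.f_smult) auto
    then show "sign_inf r \<sigma> (t j \<odot>\<^bsub>RF\<^esub> f j) i = parity_sign (t j * e j)"
      using i e[OF j] by (simp add: sign_apply parity_sign_mult)
  qed
  finally show ?thesis by (simp add: parity_sign_sum)
qed

section \<open>Logarithmic divisors\<close>

lemma q2_module_simps [simp]:
  "carrier q2_module = UNIV" "\<zero>\<^bsub>q2_module\<^esub> = 0" "x \<oplus>\<^bsub>q2_module\<^esub> y = x + y"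
  "c \<odot>\<^bsub>q2_module\<^esub> x = to_fract c * x"
  by (simp_all add: q2_module_def)

lemma module_q2_module: "Module.module class_ring q2_module"
proof (rule module_criteria)
  show "\<forall>v\<in>carrier q2_module. \<exists>w\<in>carrier q2_module. v \<oplus>\<^bsub>q2_module\<^esub> w = \<zero>\<^bsub>q2_module\<^esub>"
    by (auto intro!: exI[of _ "- v" for v])
qed (auto simp: algebra_simps class_cring.is_cring)

text \<open>If \<open>Log |\<cdot>|\<^sub>v\<close> extends to a linear map on \<open>\<R>\<^sub>F\<close>, then \<open>log_abs v\<close> is this extension. If not, the
  description operator that defines \<open>log_abs v\<close> has the same value at every argument; the image consists
  of the multiples of the degree and contains 0, so that \<open>log_abs v\<close> is the zero map.\<close>

lemma log_abs_linear:
  fixes deg :: "('a :: number_field \<Rightarrow> int) \<Rightarrow> z2" and v :: "'a \<Rightarrow> int"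
  assumes "degree_choice deg" "v \<in> finite_places"
  shows "log_abs v \<in> LinearCombinations.module_hom class_ring RF q2_module"
proof -
  let ?f = "\<lambda>x. Log2 (abs2 v x)"
  have img: "log_abs v ` carrier RF = {to_fract (c * deg v) | c. True}"
    using assms by (simp add: degree_choice_def)
  show ?thesis
  proof (cases "\<exists>g\<in>LinearCombinations.module_hom class_ring RF q2_module. \<forall>x. x \<noteq> 0 \<longrightarrow> g (tens x) = ?f x")
    case True
    then obtain g where g: "g \<in> LinearCombinations.module_hom class_ring RF q2_module"
      and gf: "\<And>x. x \<noteq> 0 \<Longrightarrow> g (tens x) = ?f x" by blast
    have "log_abs v \<alpha> = g \<alpha>" if "\<alpha> \<in> carrier RF" for \<alpha>
      unfolding log_abs_def using module_q2_module g gf that by (rule linear_ext_eq)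
    with g module_RF show ?thesis by (rule module_hom_cong)
  next
    case False
    then have undef: "log_abs v \<alpha> = (THE y. False)" for \<alpha>
      unfolding log_abs_def linear_ext_def by (intro arg_cong[where f = The] ext) blast
    then have const: "log_abs v \<alpha> = log_abs v \<beta>" for \<alpha> \<beta> by simp
    have "0 \<in> {to_fract (c * deg v) | c. True}" by (auto intro!: exI[of _ 0])
    then obtain \<beta> where "log_abs v \<beta> = 0" unfolding img[symmetric] by auto
    then have "log_abs v \<alpha> = 0" for \<alpha> using const by metis
    then show ?thesis by (simp add: LinearCombinations.module_hom_def)
  qed
qed

text \<open>For \<open>deg v = 0\<close> both sides are 0 by the convention on division by 0, and the equation makes
  \<open>log_val\<close> linear in this case as well.\<close>

lemma to_fract_log_val:
  assumes "degree_choice deg" "v \<in> finite_places" "\<alpha> \<in> carrier RF"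
  shows "to_fract (log_val deg v \<alpha>) = - log_abs v \<alpha> / to_fract (deg v)"
proof -
  obtain c where c: "log_abs v \<alpha> = to_fract (c * deg v)"
    using assms unfolding degree_choice_def by blast
  have "\<exists>!d. to_fract d = - log_abs v \<alpha> / to_fract (deg v)"
  proof (cases "deg v = 0")
    case True
    then show ?thesis by (intro ex1I[of _ 0]) auto
  next
    case False
    then have eq: "- log_abs v \<alpha> / to_fract (deg v) = to_fract (- c)" by (simp add: c)
    show ?thesis unfolding eq to_fract_eq_iff by simp
  qed
  then show ?thesis unfolding log_val_def by (rule theI')
qed

lemma log_div_hom:
  fixes deg :: "('a :: number_field \<Rightarrow> int) \<Rightarrow> z2"
  assumes deg: "degree_choice deg"
  shows "mod_hom class_ring RF function_module (log_div deg)"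
proof -
  interpret RF: Module.module "class_ring :: z2 ring" "RF :: (z2, ('a \<Rightarrow> z2) set) module"
    by (rule module_RF)
  have add: "log_val deg v (\<alpha> \<oplus>\<^bsub>RF\<^esub> \<beta>) = log_val deg v \<alpha> + log_val deg v \<beta>"
    if "v \<in> finite_places" "\<alpha> \<in> carrier RF" "\<beta> \<in> carrier RF" for v \<alpha> \<beta>
  proof -
    have "to_fract (log_val deg v (\<alpha> \<oplus>\<^bsub>RF\<^esub> \<beta>)) = to_fract (log_val deg v \<alpha> + log_val deg v \<beta>)"
      using that LinearCombinations.module_hom_add[OF log_abs_linear[OF deg that(1)] that(2,3)]
      by (simp add: to_fract_log_val[OF deg that(1)] diff_divide_distrib del: to_fract_eq_iff)
    then show ?thesis by (simp only: to_fract_eq_iff)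
  qed
  have smult: "log_val deg v (c \<odot>\<^bsub>RF\<^esub> \<alpha>) = c * log_val deg v \<alpha>"
    if "v \<in> finite_places" "\<alpha> \<in> carrier RF" for v \<alpha> c
  proof -
    have "to_fract (log_val deg v (c \<odot>\<^bsub>RF\<^esub> \<alpha>)) = to_fract (c * log_val deg v \<alpha>)"
      using that LinearCombinations.module_hom_smult[OF log_abs_linear[OF deg that(1)] _ that(2), of c]
        RF.smult_closed[of c \<alpha>]
      by (simp add: to_fract_log_val[OF deg that(1)] del: to_fract_eq_iff)
    then show ?thesis by (simp only: to_fract_eq_iff)
  qed
  show ?thesis
    by (auto simp: mod_hom_def mod_hom_axioms_def LinearCombinations.module_hom_def module_RF
        module_function_module log_div_def add smult fun_eq_iff)
qed

lemma log_div_finsum: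
  fixes deg :: "('a :: number_field \<Rightarrow> int) \<Rightarrow> z2"
  assumes "degree_choice deg" "f \<in> I \<rightarrow> carrier RF"
  shows "log_div deg (\<Oplus>\<^bsub>RF\<^esub>j\<in>I. t j \<odot>\<^bsub>RF\<^esub> f j) = (\<lambda>v. \<Sum>j\<in>I. t j * log_div deg (f j) v)"
proof -
  interpret L: mod_hom class_ring RF function_module "log_div deg" using assms(1) by (rule log_div_hom)
  have "log_div deg (\<Oplus>\<^bsub>RF\<^esub>j\<in>I. t j \<odot>\<^bsub>RF\<^esub> f j) =
      (\<Oplus>\<^bsub>function_module\<^esub>j\<in>I. log_div deg (t j \<odot>\<^bsub>RF\<^esub> f j))"
    using assms(2) by (intro L.hom_finsum) (auto intro!: L.M.smult_closed)
  also have "\<dots> = (\<lambda>v. \<Sum>j\<in>I. t j * log_div deg (f j) v)"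
    using assms(2) unfolding finsum_function_module by (intro ext sum.cong) (auto simp: Pi_iff)
  finally show ?thesis .
qed

section \<open>The logarithmic class group\<close>

lemma div_deg_eq:
  "finite T \<Longrightarrow> {v. d v \<noteq> 0} \<subseteq> T \<Longrightarrow> div_deg deg d = (\<Sum>v\<in>T. d v * deg v)"
  unfolding div_deg_def by (rule sum.mono_neutral_left) auto

lemma Dl0_eq: "Dl0 deg = function_module\<lparr>carrier := carrier (Dl0 deg)\<rparr>"
  by (simp add: Dl0_def Dl_def free_module_eq)

lemma submodule_Dl0: "LinearCombinations.submodule class_ring (carrier (Dl0 deg)) function_module"
proof (rule LinearCombinations.submodule.intro)
  fix d e :: "('a \<Rightarrow> int) \<Rightarrow> z2" and c :: z2
  assume d: "d \<in> carrier (Dl0 deg)"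
  then have d': "d \<in> carrier (free_module finite_places)" "finite {v. d v \<noteq> 0}"
    by (auto simp: Dl0_def Dl_def)
  have sub: "{v. c * d v \<noteq> 0} \<subseteq> {v. d v \<noteq> 0}" by auto
  have "div_deg deg (\<lambda>v. c * d v) = c * div_deg deg d"
    using div_deg_eq[OF d'(2) sub, of deg] by (simp add: div_deg_def sum_distrib_left mult.assoc)
  then show "c \<odot>\<^bsub>function_module\<^esub> d \<in> carrier (Dl0 deg)"
    using d LinearCombinations.submodule.smult_closed[OF submodule_free_module _ d'(1), of c]
    by (simp add: Dl0_def Dl_def)
  assume e: "e \<in> carrier (Dl0 deg)"
  then have e': "e \<in> carrier (free_module finite_places)" "finite {v. e v \<noteq> 0}"
    by (auto simp: Dl0_def Dl_def)
  let ?T = "{v. d v \<noteq> 0} \<union> {v. e v \<noteq> 0}"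
  have "div_deg deg (\<lambda>v. d v + e v) = div_deg deg d + div_deg deg e"
    using d' e' by (subst (1 2 3) div_deg_eq[of ?T]) (auto simp: sum.distrib distrib_right)
  then show "d \<oplus>\<^bsub>function_module\<^esub> e \<in> carrier (Dl0 deg)"
    using d e LinearCombinations.submodule.m_closed[OF submodule_free_module d'(1) e'(1)]
    by (simp add: Dl0_def Dl_def)
qed (auto simp: module_function_module, auto simp: Dl0_def Dl_def div_deg_def)

lemma submodule_Pl:
  assumes "degree_choice deg"
  shows "LinearCombinations.submodule class_ring (Pl deg) function_module"
  using mod_hom.im_is_submodule[OF log_div_hom[OF assms]]
  by (simp add: Pl_def mod_hom.im_def[OF log_div_hom[OF assms]])

lemma Cl_hom:
  assumes "degree_choice deg"
  shows "mod_hom class_ring (Dl0 deg) (Cl deg) (Cl_class deg)"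
  using quot_module_hom[OF submodule_Pl[OF assms] submodule_Dl0[of deg]]
  unfolding Dl0_eq[symmetric] Cl_def[symmetric] Cl_class_def[abs_def] .

lemma Cl_class_eq_iff:
  assumes "degree_choice deg"
  shows "Cl_class deg d = Cl_class deg e \<longleftrightarrow> (\<lambda>v. d v - e v) \<in> Pl deg"
  using coset_eq_iff[OF submodule_Pl[OF assms], of d e "carrier (Dl0 deg)"]
  unfolding Dl0_eq[symmetric] Cl_class_def by simp

text \<open>Both sides are additive in \<open>m\<close> and agree on unit vectors, so induction on \<open>\<Sum>\<^sub>j m\<^sub>j\<close> applies.\<close>

lemma class_of_combination:
  fixes deg :: "('a :: number_field \<Rightarrow> int) \<Rightarrow> z2" and \<nu> :: nat
  assumes deg: "degree_choice deg" and n: "\<And>j. j < \<nu> \<Longrightarrow> 1 \<le> n j"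
    and \<phi>: "\<phi> \<in> iso (sum_group {..<\<nu>} (\<lambda>j. integer_mod_group (2 ^ n j))) (add_monoid (Cl deg))"
    and a: "\<And>j. j < \<nu> \<Longrightarrow> \<aa> j \<in> carrier (Dl0 deg)"
    and a_class: "\<And>j. j < \<nu> \<Longrightarrow> Cl_class deg (\<aa> j) = \<phi> (\<lambda>i\<in>{..<\<nu>}. if i = j then 1 else 0)"
  shows "Cl_class deg (\<lambda>v. \<Sum>j<\<nu>. of_nat (m j) * \<aa> j v) = \<phi> (\<lambda>j\<in>{..<\<nu>}. int (m j) mod 2 ^ n j)"
    (is "?L m = ?R m")
proof -
  let ?G = "sum_group {..<\<nu>} (\<lambda>j. integer_mod_group (2 ^ n j))"
  let ?e = "\<lambda>k. \<lambda>i\<in>{..<\<nu>}. if i = k then 1 else 0 :: int"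
  let ?u = "\<lambda>m. \<lambda>j\<in>{..<\<nu>}. int (m j) mod 2 ^ n j"
  interpret C: mod_hom class_ring "Dl0 deg" "Cl deg" "Cl_class deg" by (rule Cl_hom[OF deg])
  have hom: "\<phi> \<in> hom ?G (add_monoid (Cl deg))" using \<phi> by (simp add: iso_def)
  have add_eq: "X \<otimes>\<^bsub>add_monoid (Cl deg)\<^esub> Y = X \<oplus>\<^bsub>Cl deg\<^esub> Y" for X Y by simp
  have u: "?u m \<in> carrier ?G" for m
    by (auto simp: carrier_sum_group carrier_integer_mod_group
        intro: finite_subset[OF _ finite_lessThan[of \<nu>]])
  have one_less: "1 < (2 :: int) ^ n j" if "j < \<nu>" for j
    using n[OF that] by (intro one_less_power) auto
  then have e: "?e k \<in> carrier ?G" if "k < \<nu>" for k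
    using that by (auto simp: carrier_sum_group carrier_integer_mod_group)
  have L: "(\<lambda>v. \<Sum>j<\<nu>. of_nat (m j) * \<aa> j v) \<in> carrier (Dl0 deg)" for m
  proof -
    interpret F: Module.module "class_ring :: z2 ring" function_module by (rule module_function_module)
    have "(\<Oplus>\<^bsub>function_module\<^esub>j\<in>{..<\<nu>}. of_nat (m j) \<odot>\<^bsub>function_module\<^esub> \<aa> j) \<in> carrier (Dl0 deg)"
      using a LinearCombinations.submodule.smult_closed[OF submodule_Dl0[of deg]]
      by (intro F.finsum_in_submodule submodule_Dl0) auto
    then show ?thesis by (simp add: finsum_function_module)
  qed
  have "\<forall>m. (\<Sum>j<\<nu>. m j) = N \<longrightarrow> ?L m = ?R m" for N
  proof (induction N)
    case 0
    have "?L m = ?R m" if "(\<Sum>j<\<nu>. m j) = 0" for m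
    proof -
      have m: "m j = 0" if "j < \<nu>" for j using \<open>(\<Sum>j<\<nu>. m j) = 0\<close> that by simp
      have "group_hom ?G (add_monoid (Cl deg)) \<phi>"
        using hom C.N.M.a_group by (simp add: group_hom_def group_hom_axioms_def)
      then have "\<phi> \<one>\<^bsub>?G\<^esub> = \<zero>\<^bsub>Cl deg\<^esub>" using group_hom.hom_one by fastforce
      moreover have "?u m = \<one>\<^bsub>?G\<^esub>" using m by (auto intro!: restrict_ext)
      moreover have "(\<lambda>v. \<Sum>j<\<nu>. of_nat (m j) * \<aa> j v) = \<zero>\<^bsub>Dl0 deg\<^esub>"
        using m by (subst Dl0_eq) simp
      ultimately show ?thesis using C.f0_is_0 by (simp only:)
    qed
    then show ?case by blast
  next
    case (Suc N)
    have "?L m = ?R m" if "(\<Sum>j<\<nu>. m j) = Suc N" for m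
    proof -
      \<comment> \<open>Remove one copy of \<open>\<aa>\<^sub>k\<close>.\<close>
      obtain k where k: "k < \<nu>" "m k \<noteq> 0"
        using \<open>(\<Sum>j<\<nu>. m j) = Suc N\<close> by (metis lessThan_iff nat.distinct(1) sum.neutral)
      define m' where "m' = m(k := m k - 1)"
      have m: "m j = m' j + (if j = k then 1 else 0)" for j using k by (simp add: m'_def)
      have "(\<Sum>j<\<nu>. m j) = (\<Sum>j<\<nu>. m' j) + 1"
        unfolding m using k by (simp add: sum.distrib)
      then have IH: "?L m' = ?R m'" using Suc \<open>(\<Sum>j<\<nu>. m j) = Suc N\<close> by simp
      have "(\<lambda>v. \<Sum>j<\<nu>. of_nat (m j) * \<aa> j v) =
          (\<lambda>v. (\<Sum>j<\<nu>. of_nat (m' j) * \<aa> j v) + \<aa> k v)"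
        unfolding m using k by (simp add: distrib_right sum.distrib if_distrib[of of_nat]
          if_distrib[of "\<lambda>x. x * _"] cong: if_cong)
      also have "\<dots> = (\<lambda>v. \<Sum>j<\<nu>. of_nat (m' j) * \<aa> j v) \<oplus>\<^bsub>Dl0 deg\<^esub> \<aa> k"
        by (subst Dl0_eq) simp
      finally have "?L m = ?R m' \<oplus>\<^bsub>Cl deg\<^esub> \<phi> (?e k)"
        using C.f_add[OF L a[OF k(1)]] IH a_class[OF k(1)] by simp
      also have "\<dots> = \<phi> (?u m' \<otimes>\<^bsub>?G\<^esub> ?e k)"
        using hom_mult[OF hom u e[OF k(1)]] unfolding add_eq by (rule sym)
      also have "?u m' \<otimes>\<^bsub>?G\<^esub> ?e k = ?u m"
        unfolding m by (auto simp: mod_simps intro!: restrict_ext)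
      finally show ?thesis .
    qed
    then show ?case by blast
  qed
  then show ?thesis by blast
qed

text \<open>The isomorphism \<open>\<phi>\<close> is surjective and injective; by the previous lemma this says that the \<open>\<aa>\<^sub>j\<close>
  generate the class group and that they have no relations but the evident ones.\<close>

lemma class_group_presentation:
  fixes deg :: "('a :: number_field \<Rightarrow> int) \<Rightarrow> z2" and \<nu> :: nat
  assumes deg: "degree_choice deg" and n: "\<And>j. j < \<nu> \<Longrightarrow> 1 \<le> n j"
    and \<phi>: "\<phi> \<in> iso (sum_group {..<\<nu>} (\<lambda>j. integer_mod_group (2 ^ n j))) (add_monoid (Cl deg))"
    and a: "\<And>j. j < \<nu> \<Longrightarrow> \<aa> j \<in> carrier (Dl0 deg)"
    and a_class: "\<And>j. j < \<nu> \<Longrightarrow> Cl_class deg (\<aa> j) = \<phi> (\<lambda>i\<in>{..<\<nu>}. if i = j then 1 else 0)"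
  shows class_group_generated:
      "d \<in> carrier (Dl0 deg) \<Longrightarrow> \<exists>m. (\<lambda>v. d v - (\<Sum>j<\<nu>. of_nat (m j) * \<aa> j v)) \<in> Pl deg"
    and class_group_independent:
      "(\<lambda>v. \<Sum>j<\<nu>. of_nat (m j) * \<aa> j v) \<in> Pl deg \<Longrightarrow> (\<And>j. j < \<nu> \<Longrightarrow> m j < 2 ^ n j) \<Longrightarrow>
        k < \<nu> \<Longrightarrow> m k = 0"
proof -
  let ?G = "sum_group {..<\<nu>} (\<lambda>j. integer_mod_group (2 ^ n j))"
  have comb: "Cl_class deg (\<lambda>v. \<Sum>j<\<nu>. of_nat (m j) * \<aa> j v) = \<phi> (\<lambda>j\<in>{..<\<nu>}. int (m j) mod 2 ^ n j)"
    for m using deg n \<phi> a a_class by (rule class_of_combination)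
  have bij: "bij_betw \<phi> (carrier ?G) (carrier (Cl deg))" using \<phi> by (simp add: iso_def)
  show "\<exists>m. (\<lambda>v. d v - (\<Sum>j<\<nu>. of_nat (m j) * \<aa> j v)) \<in> Pl deg" if d: "d \<in> carrier (Dl0 deg)"
  proof -
    have "Cl_class deg d \<in> carrier (Cl deg)" using mod_hom.f_im[OF Cl_hom[OF deg] d] .
    then obtain u where u: "u \<in> carrier ?G" "Cl_class deg d = \<phi> u"
      using bij_betw_imp_surj_on[OF bij] by auto
    have range: "u j \<in> {0..<2 ^ n j}" if "j < \<nu>" for j
      using u(1) that by (auto simp: carrier_sum_group carrier_integer_mod_group PiE_iff)
    have "(\<lambda>j\<in>{..<\<nu>}. int (nat (u j)) mod 2 ^ n j) = (\<lambda>j\<in>{..<\<nu>}. u j)"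
      using range by (intro restrict_ext) auto
    also have "\<dots> = u" using u(1) by (auto simp: carrier_sum_group)
    finally have "Cl_class deg d = Cl_class deg (\<lambda>v. \<Sum>j<\<nu>. of_nat (nat (u j)) * \<aa> j v)"
      using comb[of "\<lambda>j. nat (u j)"] u(2) by simp
    then show ?thesis by (auto simp: Cl_class_eq_iff[OF deg])
  qed
  show "m k = 0" if "(\<lambda>v. \<Sum>j<\<nu>. of_nat (m j) * \<aa> j v) \<in> Pl deg"
    "\<And>j. j < \<nu> \<Longrightarrow> m j < 2 ^ n j" and k: "k < \<nu>"
  proof -
    have "Cl_class deg (\<lambda>v. \<Sum>j<\<nu>. of_nat (m j) * \<aa> j v) =
        Cl_class deg (\<lambda>v. \<Sum>j<\<nu>. of_nat ((\<lambda>_. 0) j) * \<aa> j v)"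
      using that(1) by (simp add: Cl_class_eq_iff[OF deg])
    then have eq: "\<phi> (\<lambda>j\<in>{..<\<nu>}. int (m j) mod 2 ^ n j) =
        \<phi> (\<lambda>j\<in>{..<\<nu>}. int ((\<lambda>_. 0) j) mod 2 ^ n j)"
      unfolding comb .
    have u: "(\<lambda>j\<in>{..<\<nu>}. int (m j) mod 2 ^ n j) \<in> carrier ?G" for m
      by (auto simp: carrier_sum_group carrier_integer_mod_group
          intro: finite_subset[OF _ finite_lessThan[of \<nu>]])
    have "(\<lambda>j\<in>{..<\<nu>}. int (m j) mod 2 ^ n j) = (\<lambda>j\<in>{..<\<nu>}. int ((\<lambda>_. 0) j) mod 2 ^ n j)"
      by (rule inj_onD[OF bij_betw_imp_inj_on[OF bij] eq u u])
    from fun_cong[OF this, of k] have "int (m k) mod 2 ^ n k = 0" using k by simp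
    moreover have "int (m k) < 2 ^ n k"
      using that(2)[OF k] by (metis of_nat_less_iff of_nat_numeral of_nat_power)
    ultimately show ?thesis by simp
  qed
qed

section \<open>The narrow logarithmic class group\<close>

lemma Dl_res_eq:
  "Dl_res deg r = (direct_sum function_module (sign_module r))
     \<lparr>carrier := carrier (Dl0 deg) \<times> carrier (sign_module r)\<rparr>"
  unfolding Dl_res_def by (subst Dl0_eq) (simp add: direct_sum_def)

lemma submodule_Dl_res:
  "LinearCombinations.submodule class_ring (carrier (Dl0 deg) \<times> carrier (sign_module r))
     (direct_sum function_module (sign_module r))"
  by (intro submodule_direct_sum submodule_Dl0 module.submodule_carrier module_sign_module)

lemma div_sign_hom:
  fixes \<sigma> :: "nat \<Rightarrow> 'a :: number_field \<Rightarrow> real"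
  assumes "degree_choice deg" and \<sigma>: "\<And>i. i < r \<Longrightarrow> field_hom (\<sigma> i)"
  shows "mod_hom class_ring RF (direct_sum function_module (sign_module r))
     (\<lambda>\<alpha>. (log_div deg \<alpha>, sign_inf r \<sigma> \<alpha>))"
proof (intro mod_hom.intro mod_hom_axioms.intro module_RF direct_sum_is_module
    module_function_module module_sign_module)
  show "(\<lambda>\<alpha>. (log_div deg \<alpha>, sign_inf r \<sigma> \<alpha>)) \<in>
      LinearCombinations.module_hom class_ring RF (direct_sum function_module (sign_module r))"
    using mod_hom.f_hom[OF log_div_hom[OF assms(1)]] mod_hom.f_hom[OF sign_inf_hom[of r \<sigma>, OF \<sigma>]]
    by (auto simp: LinearCombinations.module_hom_def direct_sum_def)
qed

lemma submodule_Pl_res: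
  fixes \<sigma> :: "nat \<Rightarrow> 'a :: number_field \<Rightarrow> real"
  assumes "degree_choice deg" and \<sigma>: "\<And>i. i < r \<Longrightarrow> field_hom (\<sigma> i)"
  shows "LinearCombinations.submodule class_ring (Pl_res deg r \<sigma>)
     (direct_sum function_module (sign_module r))"
proof -
  have "Pl_res deg r \<sigma> = (\<lambda>\<alpha>. (log_div deg \<alpha>, sign_inf r \<sigma> \<alpha>)) ` carrier RF"
    by (auto simp: Pl_res_def)
  then show ?thesis
    using mod_hom.im_is_submodule[OF div_sign_hom[OF assms]]
    by (simp add: mod_hom.im_def[OF div_sign_hom[OF assms]])
qed

lemma Cl_res_hom:
  fixes \<sigma> :: "nat \<Rightarrow> 'a :: number_field \<Rightarrow> real"
  assumes "degree_choice deg" and "\<And>i. i < r \<Longrightarrow> field_hom (\<sigma> i)"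
  shows "mod_hom class_ring (Dl_res deg r) (Cl_res deg r \<sigma>) (Cl_res_class deg r \<sigma>)"
  using quot_module_hom[OF submodule_Pl_res[OF assms] submodule_Dl_res[of deg]]
  unfolding Dl_res_eq[symmetric] Cl_res_def[symmetric] Cl_res_class_def[abs_def] .

lemma Cl_res_class_eqI:
  fixes \<sigma> :: "nat \<Rightarrow> 'a :: number_field \<Rightarrow> real"
  assumes "degree_choice deg" and "\<And>i. i < r \<Longrightarrow> field_hom (\<sigma> i)"
    and s: "s \<in> carrier (sign_module r)" and \<beta>: "\<beta> \<in> carrier RF"
  shows "Cl_res_class deg r \<sigma> (\<lambda>v. log_div deg \<beta> v + d v, sign_inf r \<sigma> \<beta> \<oplus>\<^bsub>sign_module r\<^esub> s) =
    Cl_res_class deg r \<sigma> (d, s)"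
proof -
  let ?B = "direct_sum (function_module :: (z2, ('a \<Rightarrow> int) \<Rightarrow> z2) module) (sign_module r)"
  let ?z = "(log_div deg \<beta>, sign_inf r \<sigma> \<beta>)" and ?y = "(d, s)"
  let ?x = "(\<lambda>v. log_div deg \<beta> v + d v, sign_inf r \<sigma> \<beta> \<oplus>\<^bsub>sign_module r\<^esub> s)"
  interpret B: Module.module "class_ring :: z2 ring" ?B
    by (intro direct_sum_is_module module_function_module module_sign_module)
  have z: "?z \<in> carrier ?B" using mod_hom.f_im[OF div_sign_hom[OF assms(1,2)] \<beta>] by simp
  have y: "?y \<in> carrier ?B" using s by (simp add: direct_sum_def)
  have x_eq: "?x = ?z \<oplus>\<^bsub>?B\<^esub> ?y" by (simp add: direct_sum_def)
  have x: "?x \<in> carrier ?B" unfolding x_eq using z y by (rule B.M.a_closed)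
  have "?x \<ominus>\<^bsub>?B\<^esub> ?y = ?z"
    unfolding x_eq using z y by (simp add: B.M.minus_eq B.M.a_assoc B.M.r_neg del: prod.inject)
  moreover have "?z \<in> Pl_res deg r \<sigma>" using \<beta> by (auto simp: Pl_res_def)
  ultimately show ?thesis
    using coset_eq_iff[OF submodule_Pl_res[OF assms(1,2)] x y,
        where D = "carrier (Dl0 deg) \<times> carrier (sign_module r)"]
    unfolding Dl_res_eq[symmetric] Cl_res_class_def by simp
qed

lemma Cl_res_class_eq_zero_iff:
  fixes \<sigma> :: "nat \<Rightarrow> 'a :: number_field \<Rightarrow> real"
  assumes "degree_choice deg" and "\<And>i. i < r \<Longrightarrow> field_hom (\<sigma> i)"
    and s: "s \<in> carrier (sign_module r)"
  shows "Cl_res_class deg r \<sigma> (d, s) = \<zero>\<^bsub>Cl_res deg r \<sigma>\<^esub> \<longleftrightarrow> (d, s) \<in> Pl_res deg r \<sigma>"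
proof -
  let ?B = "direct_sum (function_module :: (z2, ('a \<Rightarrow> int) \<Rightarrow> z2) module) (sign_module r)"
  interpret B: Module.module "class_ring :: z2 ring" ?B
    by (intro direct_sum_is_module module_function_module module_sign_module)
  have x: "(d, s) \<in> carrier ?B" using s by (simp add: direct_sum_def)
  have "\<zero>\<^bsub>Cl_res deg r \<sigma>\<^esub> = Cl_res_class deg r \<sigma> \<zero>\<^bsub>Dl_res deg r\<^esub>"
    by (rule mod_hom.f0_is_0[OF Cl_res_hom[OF assms(1,2)], symmetric])
  also have "\<zero>\<^bsub>Dl_res deg r\<^esub> = \<zero>\<^bsub>?B\<^esub>" by (simp add: Dl_res_eq)
  finally have zero: "\<zero>\<^bsub>Cl_res deg r \<sigma>\<^esub> = Cl_res_class deg r \<sigma> \<zero>\<^bsub>?B\<^esub>" .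
  have "(d, s) \<ominus>\<^bsub>?B\<^esub> \<zero>\<^bsub>?B\<^esub> = (d, s)"
    using x by (simp add: B.M.minus_eq)
  then show ?thesis
    using coset_eq_iff[OF submodule_Pl_res[OF assms(1,2)] x B.M.zero_closed,
        where D = "carrier (Dl0 deg) \<times> carrier (sign_module r)"]
    unfolding zero Dl_res_eq[symmetric] Cl_res_class_def by simp
qed

lemma sum_lessThan_add:
  fixes f :: "nat \<Rightarrow> 'b :: comm_monoid_add"
  shows "(\<Sum>k<m + n. f k) = (\<Sum>k<m. f k) + (\<Sum>k<n. f (m + k))"
  by (induction n) (simp_all add: add.assoc)

lemma prod_lessThan_add:
  fixes f :: "nat \<Rightarrow> 'b :: comm_monoid_mult"
  shows "(\<Prod>k<m + n. f k) = (\<Prod>k<m. f k) * (\<Prod>k<n. f (m + k))"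
  by (induction n) (simp_all add: mult.assoc)

text \<open>The relations are thus the \<open>x\<close> for which the pair on the right is principal in the narrow sense.\<close>

lemma finsum_res_generators:
  fixes \<sigma> :: "nat \<Rightarrow> 'a :: number_field \<Rightarrow> real"
  assumes deg: "degree_choice deg" and \<sigma>: "\<And>i. i < r \<Longrightarrow> field_hom (\<sigma> i)"
    and a: "\<And>j. j < \<nu> \<Longrightarrow> \<aa> j \<in> carrier (Dl0 deg)"
  shows "(\<Oplus>\<^bsub>Cl_res deg r \<sigma>\<^esub>k\<in>{..<\<nu> + r}. x k \<odot>\<^bsub>Cl_res deg r \<sigma>\<^esub> res_generators deg r \<sigma> \<nu> \<aa> k) =
    Cl_res_class deg r \<sigma> (\<lambda>v. \<Sum>j<\<nu>. x j * \<aa> j v, \<lambda>i\<in>{..<r}. parity_sign (x (\<nu> + i)))"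
    and res_generators_closed: "res_generators deg r \<sigma> \<nu> \<aa> \<in> {..<\<nu> + r} \<rightarrow> carrier (Cl_res deg r \<sigma>)"
proof -
  let ?S = "sign_module r"
  define d where "d k = (if k < \<nu> then \<aa> k else (\<lambda>_. 0))" for k
  define s where "s k = (if k < \<nu> then (\<lambda>i\<in>{..<r}. 1) else sign_basis r (k - \<nu>))" for k
  interpret Q: mod_hom class_ring "Dl_res deg r" "Cl_res deg r \<sigma>" "Cl_res_class deg r \<sigma>"
    using deg \<sigma> by (rule Cl_res_hom)
  have D: "Module.module class_ring (Dl0 deg)"
    using LinearCombinations.module.submodule_is_module[OF module_function_module submodule_Dl0]
    unfolding Dl0_eq[symmetric] .
  interpret D: Module.module "class_ring :: z2 ring" "Dl0 deg" by (rule D)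
  interpret S: Module.module "class_ring :: z2 ring" ?S by (rule module_sign_module)
  have zero: "\<zero>\<^bsub>Dl0 deg\<^esub> = (\<lambda>_. 0)" by (subst Dl0_eq) simp
  have d: "d k \<in> carrier (Dl0 deg)" for k using a D.M.zero_closed by (simp add: d_def zero)
  have s: "s k \<in> carrier ?S" for k
    by (auto simp: s_def sign_basis_def intro!: restrict_sign_closed)
  have ds: "(d k, s k) \<in> carrier (Dl_res deg r)" for k
    using d s by (simp add: Dl_res_def direct_sum_def)
  have gen: "res_generators deg r \<sigma> \<nu> \<aa> k = Cl_res_class deg r \<sigma> (d k, s k)" for k
    by (simp add: res_generators_def d_def s_def)
  show "res_generators deg r \<sigma> \<nu> \<aa> \<in> {..<\<nu> + r} \<rightarrow> carrier (Cl_res deg r \<sigma>)"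
    using ds by (auto simp: gen)
  have "(\<Oplus>\<^bsub>Cl_res deg r \<sigma>\<^esub>k\<in>{..<\<nu> + r}. x k \<odot>\<^bsub>Cl_res deg r \<sigma>\<^esub> res_generators deg r \<sigma> \<nu> \<aa> k) =
      (\<Oplus>\<^bsub>Cl_res deg r \<sigma>\<^esub>k\<in>{..<\<nu> + r}. Cl_res_class deg r \<sigma> (x k \<odot>\<^bsub>Dl_res deg r\<^esub> (d k, s k)))"
    using ds by (simp add: gen)
  also have "\<dots> = Cl_res_class deg r \<sigma> (\<Oplus>\<^bsub>Dl_res deg r\<^esub>k\<in>{..<\<nu> + r}. x k \<odot>\<^bsub>Dl_res deg r\<^esub> (d k, s k))"
    using ds by (intro Q.hom_finsum[symmetric]) (auto intro!: Q.M.smult_closed)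
  also have "(\<Oplus>\<^bsub>Dl_res deg r\<^esub>k\<in>{..<\<nu> + r}. x k \<odot>\<^bsub>Dl_res deg r\<^esub> (d k, s k)) =
      (\<Oplus>\<^bsub>direct_sum (Dl0 deg) ?S\<^esub>k\<in>{..<\<nu> + r}. (x k \<odot>\<^bsub>Dl0 deg\<^esub> d k, x k \<odot>\<^bsub>?S\<^esub> s k))"
    by (simp add: Dl_res_def direct_sum_def)
  also have "\<dots> = (\<Oplus>\<^bsub>Dl0 deg\<^esub>k\<in>{..<\<nu> + r}. x k \<odot>\<^bsub>Dl0 deg\<^esub> d k, \<Oplus>\<^bsub>?S\<^esub>k\<in>{..<\<nu> + r}. x k \<odot>\<^bsub>?S\<^esub> s k)"
    using d s by (intro finsum_direct_sum[OF D module_sign_module])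
      (auto intro!: D.smult_closed S.smult_closed)
  also have "(\<Oplus>\<^bsub>Dl0 deg\<^esub>k\<in>{..<\<nu> + r}. x k \<odot>\<^bsub>Dl0 deg\<^esub> d k) = (\<lambda>v. \<Sum>j<\<nu>. x j * \<aa> j v)"
  proof -
    have "x k \<odot>\<^bsub>Dl0 deg\<^esub> d k \<in> carrier (Dl0 deg)" for k using d by (intro D.smult_closed) auto
    then have "(\<Oplus>\<^bsub>Dl0 deg\<^esub>k\<in>{..<\<nu> + r}. x k \<odot>\<^bsub>Dl0 deg\<^esub> d k) =
        (\<Oplus>\<^bsub>function_module\<^esub>k\<in>{..<\<nu> + r}. x k \<odot>\<^bsub>Dl0 deg\<^esub> d k)"
      using finsum_submodule[OF submodule_Dl0, of "\<lambda>k. x k \<odot>\<^bsub>Dl0 deg\<^esub> d k" "{..<\<nu> + r}" deg]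
      unfolding Dl0_eq[symmetric] by simp
    also have "\<dots> = (\<lambda>v. \<Sum>k<\<nu> + r. x k * d k v)"
      unfolding finsum_function_module by (subst Dl0_eq) simp
    also have "\<dots> = (\<lambda>v. \<Sum>j<\<nu>. x j * \<aa> j v)"
      by (simp add: sum_lessThan_add d_def)
    finally show ?thesis .
  qed
  also have "(\<Oplus>\<^bsub>?S\<^esub>k\<in>{..<\<nu> + r}. x k \<odot>\<^bsub>?S\<^esub> s k) = (\<lambda>i\<in>{..<r}. parity_sign (x (\<nu> + i)))"
  proof (rule sign_module_eqI[of _ r])
    have xs: "x k \<odot>\<^bsub>?S\<^esub> s k \<in> carrier ?S" for k using s by (intro S.smult_closed) auto
    then show "(\<Oplus>\<^bsub>?S\<^esub>k\<in>{..<\<nu> + r}. x k \<odot>\<^bsub>?S\<^esub> s k) \<in> carrier ?S"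
      by (intro S.M.finsum_closed) auto
    show "(\<lambda>i\<in>{..<r}. parity_sign (x (\<nu> + i))) \<in> carrier ?S"
      by (rule restrict_sign_closed) (simp add: parity_sign_def)
    fix i assume i: "i < r"
    have "(\<Oplus>\<^bsub>?S\<^esub>k\<in>{..<\<nu> + r}. x k \<odot>\<^bsub>?S\<^esub> s k) i = (\<Prod>k<\<nu> + r. if 2 dvd x k then 1 else s k i)"
      using xs i by (subst finsum_sign_module) (auto simp: sign_apply)
    also have "\<dots> = (\<Prod>l<r. if l = i then parity_sign (x (\<nu> + l)) else 1)"
      using i unfolding prod_lessThan_add
      by (simp add: s_def sign_basis_def parity_sign_def prod.If_cases)
    also have "\<dots> = parity_sign (x (\<nu> + i))" using i by simp
    finally show "(\<Oplus>\<^bsub>?S\<^esub>k\<in>{..<\<nu> + r}. x k \<odot>\<^bsub>?S\<^esub> s k) i = (\<lambda>i\<in>{..<r}. parity_sign (x (\<nu> + i))) i"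
      using i by simp
  qed
  finally show "(\<Oplus>\<^bsub>Cl_res deg r \<sigma>\<^esub>k\<in>{..<\<nu> + r}. x k \<odot>\<^bsub>Cl_res deg r \<sigma>\<^esub> res_generators deg r \<sigma> \<nu> \<aa> k) =
    Cl_res_class deg r \<sigma> (\<lambda>v. \<Sum>j<\<nu>. x j * \<aa> j v, \<lambda>i\<in>{..<r}. parity_sign (x (\<nu> + i)))" .
qed

section \<open>The column space of the relation matrix\<close>

lemma module_module_vec: "Module.module class_ring (module_vec TYPE('c :: comm_ring_1) N)"
  by unfold_locales
    (auto simp: module_vec_simps class_ring_simps Units_def add_smult_distrib_vec smult_add_distrib_vec
      intro!: bexI[of _ "- _"])

lemma index_finsum_vec:
  fixes f :: "'b \<Rightarrow> 'c :: comm_ring_1 vec"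
  assumes "f \<in> A \<rightarrow> carrier_vec N" "finite A" "i < N"
  shows "(\<Oplus>\<^bsub>module_vec TYPE('c) N\<^esub>k\<in>A. f k) $ i = (\<Sum>k\<in>A. f k $ i)"
proof -
  interpret Module.module "class_ring :: 'c ring" "module_vec TYPE('c) N" by (rule module_module_vec)
  show ?thesis using assms(2,1)
  proof (induction A)
    case (insert k A)
    then have eq: "(\<Oplus>\<^bsub>module_vec TYPE('c) N\<^esub>k\<in>insert k A. f k) =
        f k + (\<Oplus>\<^bsub>module_vec TYPE('c) N\<^esub>k\<in>A. f k)"
      by (subst M.finsum_insert) (auto simp: module_vec_simps)
    have "(\<Oplus>\<^bsub>module_vec TYPE('c) N\<^esub>k\<in>A. f k) \<in> carrier_vec N"
      using M.finsum_closed[of f A] insert.prems by (simp add: module_vec_simps)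
    then show ?case using insert assms(3) by (simp add: eq)
  qed (use assms(3) in \<open>simp add: module_vec_simps\<close>)
qed

lemma mem_span_cols_iff:
  fixes A :: "'c :: comm_ring_1 mat"
  assumes A: "A \<in> carrier_mat N K"
  shows "x \<in> LinearCombinations.module.span class_ring (module_vec TYPE('c) N) (set (cols A)) \<longleftrightarrow>
    x \<in> carrier_vec N \<and> (\<exists>y. \<forall>i<N. x $ i = (\<Sum>k<K. y k * A $$ (i, k)))"
proof -
  let ?V = "module_vec TYPE('c) N"
  interpret V: Module.module "class_ring :: 'c ring" ?V by (rule module_module_vec)
  have col: "col A k \<in> carrier_vec N" for k using A by auto
  have cols: "set (cols A) = col A ` {..<K}" using A by (auto simp: cols_def)
  have closed: "(\<Oplus>\<^bsub>?V\<^esub>k\<in>{..<K}. y k \<odot>\<^bsub>?V\<^esub> col A k) \<in> carrier_vec N" for y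
    using V.M.finsum_closed[of "\<lambda>k. y k \<odot>\<^bsub>?V\<^esub> col A k" "{..<K}"] col by (simp add: module_vec_simps)
  have index: "(\<Oplus>\<^bsub>?V\<^esub>k\<in>{..<K}. y k \<odot>\<^bsub>?V\<^esub> col A k) $ i = (\<Sum>k<K. y k * A $$ (i, k))"
    if "i < N" for y i
    using that col A by (subst index_finsum_vec) (auto simp: module_vec_simps intro!: sum.cong)
  have "x = (\<Oplus>\<^bsub>?V\<^esub>k\<in>{..<K}. y k \<odot>\<^bsub>?V\<^esub> col A k) \<longleftrightarrow>
      x \<in> carrier_vec N \<and> (\<forall>i<N. x $ i = (\<Sum>k<K. y k * A $$ (i, k)))" for y
  proof
    assume "x \<in> carrier_vec N \<and> (\<forall>i<N. x $ i = (\<Sum>k<K. y k * A $$ (i, k)))"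
    then show "x = (\<Oplus>\<^bsub>?V\<^esub>k\<in>{..<K}. y k \<odot>\<^bsub>?V\<^esub> col A k)"
      using closed[of y] index[of _ y] by (intro eq_vecI) auto
  qed (use closed index in auto)
  moreover have "x \<in> V.span (set (cols A)) \<longleftrightarrow> (\<exists>y. x = (\<Oplus>\<^bsub>?V\<^esub>k\<in>{..<K}. y k \<odot>\<^bsub>?V\<^esub> col A k))"
    unfolding cols using V.span_image[of "{..<K}" "col A"] col by (auto simp: module_vec_simps)
  ultimately show ?thesis by auto
qed

text \<open>The unknowns \<open>t\<close>, \<open>w\<close>, \<open>z\<close> and \<open>\<eta>\<close> are the coefficients of the four blocks of columns: those of the
  \<open>\<alpha>\<^sub>j\<close>, of \<open>2 I\<close>, of the \<open>\<epsilon>\<^sub>k\<close> and of \<open>-1\<close>.\<close>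

lemma mem_span_relation_matrix_iff:
  "x \<in> LinearCombinations.module.span class_ring (module_vec TYPE(z2) (\<nu> + r))
       (set (cols (relation_matrix \<nu> r s n c b))) \<longleftrightarrow>
    x \<in> carrier_vec (\<nu> + r) \<and> (\<exists>t w z \<eta>. (\<forall>j<\<nu>. x $ j = 2 ^ n j * t j) \<and>
      (\<forall>i<r. x $ (\<nu> + i) =
        (\<Sum>j<\<nu>. t j * of_nat (c i j)) + 2 * w i + (\<Sum>k<s. z k * of_nat (b i k)) + \<eta>))"
proof -
  let ?A = "relation_matrix \<nu> r s n c b" and ?K = "\<nu> + (r + s + 1)"
  have A: "?A \<in> carrier_mat (\<nu> + r) ?K"
    by (intro carrier_matI) (simp_all add: relation_matrix_def mat_diag_def)
  have upper: "(\<Sum>k<?K. y k * ?A $$ (j, k)) = 2 ^ n j * y j" if "j < \<nu>" for y j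
  proof -
    have "(\<Sum>k<?K. y k * ?A $$ (j, k)) = (\<Sum>k<\<nu>. y k * (if j = k then 2 ^ n k else 0))"
      unfolding sum_lessThan_add using that by (simp add: relation_matrix_def mat_diag_def)
    also have "\<dots> = 2 ^ n j * y j"
      using that by (simp add: if_distrib[of "\<lambda>a. y _ * a"] mult.commute cong: if_cong)
    finally show ?thesis .
  qed
  have lower: "(\<Sum>k<?K. y k * ?A $$ (\<nu> + i, k)) =
      (\<Sum>j<\<nu>. y j * of_nat (c i j)) + 2 * y (\<nu> + i) +
      (\<Sum>k<s. y (\<nu> + (r + k)) * of_nat (b i k)) + y (\<nu> + (r + s))" if "i < r" for y i
  proof -
    have "(\<Sum>k<r. y (\<nu> + k) * ?A $$ (\<nu> + i, \<nu> + k)) = (\<Sum>k<r. if k = i then 2 * y (\<nu> + i) else 0)"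
      using that by (intro sum.cong) (auto simp: relation_matrix_def mat_diag_def)
    then have "(\<Sum>k<r. y (\<nu> + k) * ?A $$ (\<nu> + i, \<nu> + k)) = 2 * y (\<nu> + i)" using that by simp
    moreover have "(\<Sum>k<\<nu>. y k * ?A $$ (\<nu> + i, k)) = (\<Sum>j<\<nu>. y j * of_nat (c i j))"
      using that by (intro sum.cong) (auto simp: relation_matrix_def mat_diag_def)
    moreover have "(\<Sum>k<s. y (\<nu> + (r + k)) * ?A $$ (\<nu> + i, \<nu> + (r + k))) =
        (\<Sum>k<s. y (\<nu> + (r + k)) * of_nat (b i k))"
      using that by (intro sum.cong) (auto simp: relation_matrix_def mat_diag_def)
    moreover have "?A $$ (\<nu> + i, \<nu> + (r + s)) = 1"
      using that by (simp add: relation_matrix_def mat_diag_def)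
    ultimately show ?thesis unfolding sum_lessThan_add by (simp add: add.assoc)
  qed
  have split: "(\<forall>i<\<nu> + r. P i) \<longleftrightarrow> (\<forall>j<\<nu>. P j) \<and> (\<forall>i<r. P (\<nu> + i))" for P
    by (metis add_diff_inverse_nat add_less_cancel_left linorder_not_less trans_less_add1)
  show ?thesis
    unfolding mem_span_cols_iff[OF A] split
  proof (intro conj_cong refl iffI)
    assume "\<exists>y. (\<forall>j<\<nu>. x $ j = (\<Sum>k<?K. y k * ?A $$ (j, k))) \<and>
      (\<forall>i<r. x $ (\<nu> + i) = (\<Sum>k<?K. y k * ?A $$ (\<nu> + i, k)))"
    then obtain y where "\<forall>j<\<nu>. x $ j = 2 ^ n j * y j"
      "\<forall>i<r. x $ (\<nu> + i) = (\<Sum>j<\<nu>. y j * of_nat (c i j)) + 2 * y (\<nu> + i) +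
        (\<Sum>k<s. y (\<nu> + (r + k)) * of_nat (b i k)) + y (\<nu> + (r + s))"
      using upper lower by auto
    then show "\<exists>t w z \<eta>. (\<forall>j<\<nu>. x $ j = 2 ^ n j * t j) \<and> (\<forall>i<r. x $ (\<nu> + i) =
        (\<Sum>j<\<nu>. t j * of_nat (c i j)) + 2 * w i + (\<Sum>k<s. z k * of_nat (b i k)) + \<eta>)"
      by (intro exI[of _ y] exI[of _ "\<lambda>i. y (\<nu> + i)"] exI[of _ "\<lambda>k. y (\<nu> + (r + k))"]
          exI[of _ "y (\<nu> + (r + s))"] conjI)
  next
    assume "\<exists>t w z \<eta>. (\<forall>j<\<nu>. x $ j = 2 ^ n j * t j) \<and> (\<forall>i<r. x $ (\<nu> + i) =
        (\<Sum>j<\<nu>. t j * of_nat (c i j)) + 2 * w i + (\<Sum>k<s. z k * of_nat (b i k)) + \<eta>)"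
    then obtain t w z \<eta> where *: "\<forall>j<\<nu>. x $ j = 2 ^ n j * t j" "\<forall>i<r. x $ (\<nu> + i) =
        (\<Sum>j<\<nu>. t j * of_nat (c i j)) + 2 * w i + (\<Sum>k<s. z k * of_nat (b i k)) + \<eta>"
      by blast
    define y where "y k = (if k < \<nu> then t k else if k < \<nu> + r then w (k - \<nu>)
      else if k < \<nu> + (r + s) then z (k - (\<nu> + r)) else \<eta>)" for k
    have "y j = t j" if "j < \<nu>" for j using that by (simp add: y_def)
    moreover have "y (\<nu> + i) = w i" if "i < r" for i using that by (simp add: y_def)
    moreover have "y (\<nu> + (r + k)) = z k" if "k < s" for k using that by (simp add: y_def)
    moreover have "y (\<nu> + (r + s)) = \<eta>" by (simp add: y_def)
    ultimately have "(\<forall>j<\<nu>. x $ j = (\<Sum>k<?K. y k * ?A $$ (j, k))) \<and>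
      (\<forall>i<r. x $ (\<nu> + i) = (\<Sum>k<?K. y k * ?A $$ (\<nu> + i, k)))"
      using * upper[of _ y] lower[of _ y] by simp
    then show "\<exists>y. (\<forall>j<\<nu>. x $ j = (\<Sum>k<?K. y k * ?A $$ (j, k))) \<and>
      (\<forall>i<r. x $ (\<nu> + i) = (\<Sum>k<?K. y k * ?A $$ (\<nu> + i, k)))" by blast
  qed
qed

section \<open>Generators and relations\<close>

theorem mainTheorem1:
  fixes r c \<nu> :: nat
    and \<sigma> :: "nat \<Rightarrow> 'a :: number_field \<Rightarrow> real"
    and deg :: "('a \<Rightarrow> int) \<Rightarrow> z2"
    and n :: "nat \<Rightarrow> nat"
    and \<phi> :: "(nat \<Rightarrow> int) \<Rightarrow> (('a \<Rightarrow> int) \<Rightarrow> z2) set"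
    and \<aa> :: "nat \<Rightarrow> ('a \<Rightarrow> int) \<Rightarrow> z2"
    and \<alpha> \<epsilon> :: "nat \<Rightarrow> ('a \<Rightarrow> z2) set"
    and cc b :: "nat \<Rightarrow> nat \<Rightarrow> nat"
  assumes real_places: "bij_betw \<sigma> {..<r} real_embeddings" "r \<ge> 1"
    and complex_places: "card (complex_places :: ('a \<Rightarrow> complex) set set) = c"
    and deg: "degree_choice deg"
    and exponents: "\<And>j. j < \<nu> \<Longrightarrow> 1 \<le> n j" "\<And>i j. i \<le> j \<Longrightarrow> j < \<nu> \<Longrightarrow> n i \<le> n j"
    and class_group:
      "\<phi> \<in> iso (sum_group {..<\<nu>} (\<lambda>j. integer_mod_group (2 ^ n j))) (add_monoid (Cl deg))"
    and representatives: "\<And>j. j < \<nu> \<Longrightarrow> \<aa> j \<in> carrier (Dl0 deg)"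
      "\<And>j. j < \<nu> \<Longrightarrow> Cl_class deg (\<aa> j) = \<phi> (\<lambda>i\<in>{..<\<nu>}. if i = j then 1 else 0)"
    and \<alpha>: "\<And>j. j < \<nu> \<Longrightarrow> \<alpha> j \<in> carrier RF"
      "\<And>j. j < \<nu> \<Longrightarrow> 2 ^ n j \<odot>\<^bsub>Dl0 deg\<^esub> \<aa> j = log_div deg (\<alpha> j)"
    and cc: "\<And>i j. i < r \<Longrightarrow> j < \<nu> \<Longrightarrow> cc i j \<in> {0, 1}"
      "\<And>j. j < \<nu> \<Longrightarrow> sign_inf r \<sigma> (\<alpha> j) = (\<lambda>i\<in>{..<r}. (- 1) ^ cc i j)"
    and units: "\<And>k. k < r + c \<Longrightarrow> \<epsilon> k \<in> carrier RF"
      "bij_betw (\<lambda>(s, e). s \<oplus>\<^bsub>RF\<^esub> e)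
         ({tens 1, tens (- 1)} \<times> LinearCombinations.module.span class_ring RF (\<epsilon> ` {..<r + c})) (log_units deg)"
    and b: "\<And>i k. i < r \<Longrightarrow> k < r + c \<Longrightarrow> b i k \<in> {0, 1}"
      "\<And>k. k < r + c \<Longrightarrow> sign_inf r \<sigma> (\<epsilon> k) =
         (\<Oplus>\<^bsub>sign_module r\<^esub>i\<in>{..<r}. of_nat (b i k) \<odot>\<^bsub>sign_module r\<^esub> sign_basis r i)"
  shows "LinearCombinations.module.span class_ring (Cl_res deg r \<sigma>) (res_generators deg r \<sigma> \<nu> \<aa> ` {..<\<nu> + r})
           = carrier (Cl_res deg r \<sigma>)
       \<and> relation_module (Cl_res deg r \<sigma>) (\<nu> + r) (res_generators deg r \<sigma> \<nu> \<aa>)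
           = LinearCombinations.module.span class_ring (module_vec TYPE(z2) (\<nu> + r))
               (set (cols (relation_matrix \<nu> r (r + c) n cc b)))"
proof (intro conjI)
  let ?L = "log_div deg" and ?S = "sign_inf r \<sigma>" and ?C = "Cl_res deg r \<sigma>"
  let ?g = "res_generators deg r \<sigma> \<nu> \<aa>"
  have \<sigma>: "field_hom (\<sigma> i)" if "i < r" for i
    using bij_betwE[OF real_places(1)] that by (auto simp: real_embeddings_def)
  interpret L: mod_hom class_ring RF function_module ?L by (rule log_div_hom[OF deg])
  interpret SM: Module.module "class_ring :: z2 ring" "sign_module r" by (rule module_sign_module)
  have S_hom: "mod_hom class_ring RF (sign_module r) ?S" by (rule sign_inf_hom[OF \<sigma>])
  have C_hom: "mod_hom class_ring (Dl_res deg r) ?C (Cl_res_class deg r \<sigma>)"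
    by (rule Cl_res_hom[OF deg \<sigma>])
  interpret C: Module.module "class_ring :: z2 ring" ?C using C_hom by (rule mod_hom.axioms(2))
  have S_closed: "?S \<beta> \<in> carrier (sign_module r)" if "\<beta> \<in> carrier RF" for \<beta>
    by (rule mod_hom.f_im[OF S_hom that])
  have S_add: "?S (\<beta> \<oplus>\<^bsub>RF\<^esub> \<gamma>) i = ?S \<beta> i * ?S \<gamma> i"
    if "\<beta> \<in> carrier RF" "\<gamma> \<in> carrier RF" "i < r" for \<beta> \<gamma> i
    using LinearCombinations.module_hom_add[OF mod_hom.f_hom[OF S_hom] that(1,2)] that(3) by (simp add: sign_apply)
  have comb: "(\<Oplus>\<^bsub>?C\<^esub>k\<in>{..<\<nu> + r}. x k \<odot>\<^bsub>?C\<^esub> ?g k) =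
      Cl_res_class deg r \<sigma> (\<lambda>v. \<Sum>j<\<nu>. x j * \<aa> j v, \<lambda>i\<in>{..<r}. parity_sign (x (\<nu> + i)))" for x
    using deg \<sigma> representatives(1) by (rule finsum_res_generators)
  have g_closed: "?g \<in> {..<\<nu> + r} \<rightarrow> carrier ?C"
    using deg \<sigma> representatives(1) by (rule res_generators_closed)
  have parity_closed: "(\<lambda>i\<in>{..<r}. parity_sign (y i)) \<in> carrier (sign_module r)" for y
    by (rule restrict_sign_closed) (simp add: parity_sign_def)
  have generated: "\<exists>m. (\<lambda>v. d v - (\<Sum>j<\<nu>. of_nat (m j) * \<aa> j v)) \<in> Pl deg"
    if "d \<in> carrier (Dl0 deg)" for d
    using deg exponents(1) class_group representatives that by (rule class_group_generated)
  have independent: "m k = 0"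
    if "(\<lambda>v. \<Sum>j<\<nu>. of_nat (m j) * \<aa> j v) \<in> Pl deg" "\<And>j. j < \<nu> \<Longrightarrow> m j < 2 ^ n j" "k < \<nu>"
    for m k
    using deg exponents(1) class_group representatives that by (rule class_group_independent)

  have span: "C.span (?g ` {..<\<nu> + r}) =
      {\<Oplus>\<^bsub>?C\<^esub>k\<in>{..<\<nu> + r}. z k \<odot>\<^bsub>?C\<^esub> ?g k | z. z \<in> {..<\<nu> + r} \<rightarrow> carrier class_ring}"
    by (rule C.span_image[OF finite_lessThan g_closed])
  show "C.span (?g ` {..<\<nu> + r}) = carrier ?C"
  proof
    show "C.span (?g ` {..<\<nu> + r}) \<subseteq> carrier ?C"
      using g_closed by (intro C.span_is_subset2) auto
    show "carrier ?C \<subseteq> C.span (?g ` {..<\<nu> + r})"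
    proof
      fix X assume "X \<in> carrier ?C"
      then obtain d s where ds: "d \<in> carrier (Dl0 deg)" "s \<in> carrier (sign_module r)"
        and X: "X = Cl_res_class deg r \<sigma> (d, s)"
        by (auto simp: Cl_res_def quot_carrier Cl_res_class_def Dl_res_def direct_sum_def)
      obtain m where "(\<lambda>v. d v - (\<Sum>j<\<nu>. of_nat (m j) * \<aa> j v)) \<in> Pl deg"
        using generated[OF ds(1)] by blast
      then obtain \<beta> where \<beta>: "\<beta> \<in> carrier RF"
        and L\<beta>: "?L \<beta> = (\<lambda>v. d v - (\<Sum>j<\<nu>. of_nat (m j) * \<aa> j v))"
        by (auto simp: Pl_def)
      \<comment> \<open>The parity of the last \<open>r\<close> coefficients corrects the signs of \<open>\<beta>\<close> to \<open>s\<close>.\<close>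
      define z :: "nat \<Rightarrow> z2" where "z k = (if k < \<nu> then of_nat (m k)
        else if s (k - \<nu>) = ?S \<beta> (k - \<nu>) then 0 else 1)" for k
      have zm: "(\<Sum>j<\<nu>. z j * \<aa> j v) = (\<Sum>j<\<nu>. of_nat (m j) * \<aa> j v)" for v
        by (intro sum.cong) (auto simp: z_def)
      have d_eq: "d = (\<lambda>v. ?L \<beta> v + (\<Sum>j<\<nu>. z j * \<aa> j v))"
        by (simp add: L\<beta> zm)
      have s_eq: "s = ?S \<beta> \<oplus>\<^bsub>sign_module r\<^esub> (\<lambda>i\<in>{..<r}. parity_sign (z (\<nu> + i)))"
      proof (rule sign_module_eqI[of _ r])
        show "?S \<beta> \<oplus>\<^bsub>sign_module r\<^esub> (\<lambda>i\<in>{..<r}. parity_sign (z (\<nu> + i))) \<in> carrier (sign_module r)"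
          using S_closed[OF \<beta>] parity_closed by (rule SM.M.a_closed)
        fix i assume i: "i < r"
        show "s i = (?S \<beta> \<oplus>\<^bsub>sign_module r\<^esub> (\<lambda>i\<in>{..<r}. parity_sign (z (\<nu> + i)))) i"
          using ds(2) S_closed[OF \<beta>] i by (auto simp: sign_apply z_def elim!: sign_cases)
      qed (rule ds(2))
      have "X = (\<Oplus>\<^bsub>?C\<^esub>k\<in>{..<\<nu> + r}. z k \<odot>\<^bsub>?C\<^esub> ?g k)"
        unfolding X comb
        by (subst d_eq, subst s_eq) (rule Cl_res_class_eqI[OF deg \<sigma> parity_closed \<beta>])
      then show "X \<in> C.span (?g ` {..<\<nu> + r})" unfolding span by auto
    qed
  qed

  have tens: "tens 1 \<in> carrier (RF :: (z2, ('a \<Rightarrow> z2) set) module)"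
    "tens (- 1) \<in> carrier (RF :: (z2, ('a \<Rightarrow> z2) set) module)"
    by (auto intro!: tens_closed)
  have S_tens: "?S (tens 1) i = parity_sign 0" "?S (tens (- 1)) i = parity_sign 1" if i: "i < r" for i
  proof -
    interpret field_hom "\<sigma> i" by (rule \<sigma>[OF i])
    show "?S (tens 1) i = parity_sign 0" "?S (tens (- 1)) i = parity_sign 1"
      using i by (simp_all add: sign_inf_tens[OF \<sigma>] hom_uminus)
  qed
  have \<epsilon>_sub: "\<epsilon> ` {..<r + c} \<subseteq> carrier RF" using units(1) by auto
  have span_\<epsilon>: "L.M.span (\<epsilon> ` {..<r + c}) =
      {\<Oplus>\<^bsub>RF\<^esub>k\<in>{..<r + c}. z k \<odot>\<^bsub>RF\<^esub> \<epsilon> k | z. z \<in> {..<r + c} \<rightarrow> carrier class_ring}"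
    using units(1) by (intro L.M.span_image) auto
  have units_eq: "log_units deg =
      (\<lambda>(s, e). s \<oplus>\<^bsub>RF\<^esub> e) ` ({tens 1, tens (- 1)} \<times> L.M.span (\<epsilon> ` {..<r + c}))"
    using bij_betw_imp_surj_on[OF units(2)] by simp
  have L_units: "\<beta> \<in> log_units deg \<longleftrightarrow> \<beta> \<in> carrier RF \<and> ?L \<beta> = (\<lambda>_. 0)" for \<beta>
    by (auto simp: log_units_def log_div_def fun_eq_iff)
  have zero_span: "\<zero>\<^bsub>RF\<^esub> \<in> L.M.span (\<epsilon> ` {..<r + c})"
    using L.M.span_is_submodule[OF \<epsilon>_sub] by (simp add: LinearCombinations.submodule_def)
  \<comment> \<open>The empty combination of the \<open>\<epsilon>\<^sub>k\<close> shows that \<open>1 \<otimes> 1\<close> and \<open>1 \<otimes> (-1)\<close> are logarithmic units.\<close>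
  have L_tens: "?L (tens 1) = (\<lambda>_. 0)" "?L (tens (- 1)) = (\<lambda>_. 0)"
  proof -
    have "tens 1 \<oplus>\<^bsub>RF\<^esub> \<zero>\<^bsub>RF\<^esub> \<in> log_units deg" "tens (- 1) \<oplus>\<^bsub>RF\<^esub> \<zero>\<^bsub>RF\<^esub> \<in> log_units deg"
      unfolding units_eq using zero_span by auto
    then show "?L (tens 1) = (\<lambda>_. 0)" "?L (tens (- 1)) = (\<lambda>_. 0)" using tens by (auto simp: L_units)
  qed
  have L_\<epsilon>: "?L (\<epsilon> k) = (\<lambda>_. 0)" if k: "k < r + c" for k
  proof -
    have "\<epsilon> k \<in> L.M.span (\<epsilon> ` {..<r + c})" using k L.M.in_own_span[OF \<epsilon>_sub] by auto
    then have "tens 1 \<oplus>\<^bsub>RF\<^esub> \<epsilon> k \<in> log_units deg" unfolding units_eq by auto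
    then have "?L (tens 1 \<oplus>\<^bsub>RF\<^esub> \<epsilon> k) = (\<lambda>_. 0)" by (simp add: L_units)
    then show ?thesis using L.f_add[OF tens(1) units(1)[OF k]] L_tens(1) by simp
  qed
  have S_\<alpha>: "?S (\<alpha> j) i = parity_sign (of_nat (cc i j))" if "i < r" "j < \<nu>" for i j
    using cc(2)[OF that(2)] that(1) by (simp add: parity_sign_of_nat)
  have S_\<epsilon>: "?S (\<epsilon> k) i = parity_sign (of_nat (b i k))" if i: "i < r" and k: "k < r + c" for i k
  proof -
    have basis: "sign_basis r l \<in> carrier (sign_module r)" for l
      by (auto simp: sign_basis_def intro!: restrict_sign_closed)
    have "?S (\<epsilon> k) i = (\<Prod>l<r. (of_nat (b l k) \<odot>\<^bsub>sign_module r\<^esub> sign_basis r l) i)"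
      unfolding b(2)[OF k] using i basis by (intro finsum_sign_module) (auto intro!: SM.smult_closed)
    also have "\<dots> = (\<Prod>l<r. if l = i then parity_sign (of_nat (b i k)) else 1)"
      using i by (intro prod.cong) (auto simp: sign_apply sign_basis_def parity_sign_def)
    also have "\<dots> = parity_sign (of_nat (b i k))" using i by simp
    finally show ?thesis .
  qed
  have L_\<alpha>: "?L (\<Oplus>\<^bsub>RF\<^esub>j\<in>{..<\<nu>}. t j \<odot>\<^bsub>RF\<^esub> \<alpha> j) = (\<lambda>v. \<Sum>j<\<nu>. 2 ^ n j * t j * \<aa> j v)" for t
  proof -
    have "?L (\<alpha> j) v = 2 ^ n j * \<aa> j v" if "j < \<nu>" for j v
      unfolding \<alpha>(2)[OF that, symmetric] by (subst Dl0_eq) simp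
    then show ?thesis
      using \<alpha>(1) by (subst log_div_finsum[OF deg]) (auto intro!: sum.cong)
  qed
  have L_sum_\<epsilon>: "?L (\<Oplus>\<^bsub>RF\<^esub>k\<in>{..<r + c}. z k \<odot>\<^bsub>RF\<^esub> \<epsilon> k) = (\<lambda>_. 0)" for z
    using units(1) L_\<epsilon> by (subst log_div_finsum[OF deg]) auto
  have S_sum_\<alpha>: "?S (\<Oplus>\<^bsub>RF\<^esub>j\<in>{..<\<nu>}. t j \<odot>\<^bsub>RF\<^esub> \<alpha> j) i = parity_sign (\<Sum>j<\<nu>. t j * of_nat (cc i j))"
    if "i < r" for t i
    using \<alpha>(1) S_\<alpha> that by (intro sign_inf_finsum[OF \<sigma>]) auto
  have S_sum_\<epsilon>: "?S (\<Oplus>\<^bsub>RF\<^esub>k\<in>{..<r + c}. z k \<odot>\<^bsub>RF\<^esub> \<epsilon> k) i =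
      parity_sign (\<Sum>k<r + c. z k * of_nat (b i k))" if "i < r" for z i
    using units(1) S_\<epsilon> that by (intro sign_inf_finsum[OF \<sigma>]) auto
  have closed_\<alpha>: "(\<Oplus>\<^bsub>RF\<^esub>j\<in>{..<\<nu>}. t j \<odot>\<^bsub>RF\<^esub> \<alpha> j) \<in> carrier RF" for t
    using \<alpha>(1) by (intro L.M.M.finsum_closed) (auto intro!: L.M.smult_closed)
  have closed_\<epsilon>: "(\<Oplus>\<^bsub>RF\<^esub>k\<in>{..<r + c}. z k \<odot>\<^bsub>RF\<^esub> \<epsilon> k) \<in> carrier RF" for z
    using units(1) by (intro L.M.M.finsum_closed) (auto intro!: L.M.smult_closed)

  have relation_iff: "(\<exists>\<beta>\<in>carrier RF. ?L \<beta> = (\<lambda>v. \<Sum>j<\<nu>. x j * \<aa> j v) \<and>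
        (\<forall>i<r. ?S \<beta> i = parity_sign (x (\<nu> + i)))) \<longleftrightarrow>
      (\<exists>t w z \<eta>. (\<forall>j<\<nu>. x j = 2 ^ n j * t j) \<and> (\<forall>i<r. x (\<nu> + i) =
        (\<Sum>j<\<nu>. t j * of_nat (cc i j)) + 2 * w i + (\<Sum>k<r + c. z k * of_nat (b i k)) + \<eta>))"
    (is "?lhs \<longleftrightarrow> ?rhs") for x :: "nat \<Rightarrow> z2"
  proof
    assume ?rhs
    then obtain t w z \<eta> where x: "\<And>j. j < \<nu> \<Longrightarrow> x j = 2 ^ n j * t j"
      and y: "\<And>i. i < r \<Longrightarrow> x (\<nu> + i) =
        (\<Sum>j<\<nu>. t j * of_nat (cc i j)) + 2 * w i + (\<Sum>k<r + c. z k * of_nat (b i k)) + \<eta>"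
      by blast
    let ?A = "\<Oplus>\<^bsub>RF\<^esub>j\<in>{..<\<nu>}. t j \<odot>\<^bsub>RF\<^esub> \<alpha> j" and ?E = "\<Oplus>\<^bsub>RF\<^esub>k\<in>{..<r + c}. z k \<odot>\<^bsub>RF\<^esub> \<epsilon> k"
    \<comment> \<open>The exponent of \<open>-1\<close> matters only modulo 2.\<close>
    define T :: "('a \<Rightarrow> z2) set" where "T = (if 2 dvd \<eta> then tens 1 else tens (- 1))"
    have T: "T \<in> carrier RF" using tens by (simp add: T_def)
    have LT: "?L T = (\<lambda>_. 0)" using L_tens by (simp add: T_def)
    have ET: "?E \<oplus>\<^bsub>RF\<^esub> T \<in> carrier RF" using closed_\<epsilon> T by (rule L.M.M.a_closed)
    have "?L (?A \<oplus>\<^bsub>RF\<^esub> (?E \<oplus>\<^bsub>RF\<^esub> T)) = (\<lambda>v. \<Sum>j<\<nu>. x j * \<aa> j v)"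
      using L.f_add[OF closed_\<alpha> ET] L.f_add[OF closed_\<epsilon> T] LT x
      by (simp add: L_\<alpha> L_sum_\<epsilon> del: L.f_add)
    moreover have "?S (?A \<oplus>\<^bsub>RF\<^esub> (?E \<oplus>\<^bsub>RF\<^esub> T)) i = parity_sign (x (\<nu> + i))" if i: "i < r" for i
    proof -
      have "?S T i = parity_sign \<eta>" using S_tens[OF i] by (simp add: T_def parity_sign_def[of \<eta>])
      moreover have "parity_sign (2 * w i) = 1" by (simp add: parity_sign_def)
      ultimately show ?thesis
        unfolding y[OF i] S_add[OF closed_\<alpha> ET i] S_add[OF closed_\<epsilon> T i] S_sum_\<alpha>[OF i] S_sum_\<epsilon>[OF i]
        by (simp add: parity_sign_add)
    qed
    ultimately show ?lhs using L.M.M.a_closed[OF closed_\<alpha> ET] by blast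
  next
    assume ?lhs
    then obtain \<beta> where \<beta>: "\<beta> \<in> carrier RF" and L\<beta>: "?L \<beta> = (\<lambda>v. \<Sum>j<\<nu>. x j * \<aa> j v)"
      and S\<beta>: "\<And>i. i < r \<Longrightarrow> ?S \<beta> i = parity_sign (x (\<nu> + i))" by blast
    have "\<exists>m t. m < 2 ^ n j \<and> x j = of_nat m + 2 ^ n j * t" for j
      by (rule z2_division[of "n j" "x j"]) blast
    then obtain m t where m: "\<And>j. m j < 2 ^ n j" and mt: "\<And>j. x j = of_nat (m j) + 2 ^ n j * t j"
      by metis
    \<comment> \<open>Dividing \<open>\<beta>\<close> by \<open>\<Prod> \<alpha>\<^sub>j\<^bsup>t\<^sub>j\<^esup>\<close> reduces the coefficients of its divisor to the \<open>m\<^sub>j\<close>, which vanish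
      because the divisor is principal.\<close>
    define \<gamma> where "\<gamma> = (\<Oplus>\<^bsub>RF\<^esub>j\<in>{..<\<nu>}. t j \<odot>\<^bsub>RF\<^esub> \<alpha> j)"
    have \<gamma>: "\<gamma> \<in> carrier RF" unfolding \<gamma>_def by (rule closed_\<alpha>)
    define u where "u = \<beta> \<ominus>\<^bsub>RF\<^esub> \<gamma>"
    have u: "u \<in> carrier RF" unfolding u_def using \<beta> \<gamma> by (rule L.M.M.minus_closed)
    have Lu: "?L u = (\<lambda>v. \<Sum>j<\<nu>. of_nat (m j) * \<aa> j v)"
      unfolding u_def L.f_minus[OF \<beta> \<gamma>] L\<beta> unfolding \<gamma>_def L_\<alpha>
      by (simp add: mt distrib_right sum.distrib)
    have "?L u \<in> Pl deg" using u by (simp add: Pl_def)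
    then have "(\<lambda>v. \<Sum>j<\<nu>. of_nat (m j) * \<aa> j v) \<in> Pl deg" unfolding Lu .
    then have m0: "m j = 0" if "j < \<nu>" for j using m that by (rule independent)
    then have "?L u = (\<lambda>_. 0)" by (simp add: Lu)
    then have "u \<in> log_units deg" using u by (simp add: L_units)
    then obtain T z where T: "T \<in> {tens 1, tens (- 1)}"
      and uTz: "u = T \<oplus>\<^bsub>RF\<^esub> (\<Oplus>\<^bsub>RF\<^esub>k\<in>{..<r + c}. z k \<odot>\<^bsub>RF\<^esub> \<epsilon> k)"
      unfolding units_eq span_\<epsilon> by blast
    define \<eta> :: z2 where "\<eta> = (if T = tens 1 then 0 else 1)"
    have TRF: "T \<in> carrier RF" using T tens by auto
    have ST: "?S T i = parity_sign \<eta>" if "i < r" for i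
      using T S_tens[OF that] by (auto simp: \<eta>_def)
    have \<beta>_eq: "\<beta> = u \<oplus>\<^bsub>RF\<^esub> \<gamma>"
      unfolding u_def using \<beta> \<gamma> by (simp add: L.M.M.minus_eq L.M.M.a_assoc L.M.M.l_neg)
    let ?e = "\<lambda>i. (\<Sum>j<\<nu>. t j * of_nat (cc i j)) + (\<Sum>k<r + c. z k * of_nat (b i k)) + \<eta>"
    have "parity_sign (x (\<nu> + i)) = parity_sign (?e i)" if i: "i < r" for i
    proof -
      have "parity_sign (x (\<nu> + i)) = ?S T i * ?S (\<Oplus>\<^bsub>RF\<^esub>k\<in>{..<r + c}. z k \<odot>\<^bsub>RF\<^esub> \<epsilon> k) i * ?S \<gamma> i"
        unfolding S\<beta>[OF i, symmetric] \<beta>_eq S_add[OF u \<gamma> i]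
        unfolding uTz S_add[OF TRF closed_\<epsilon> i] ..
      then show ?thesis
        unfolding ST[OF i] S_sum_\<epsilon>[OF i] \<gamma>_def S_sum_\<alpha>[OF i] by (simp add: parity_sign_add)
    qed
    then have "\<exists>w. i < r \<longrightarrow> x (\<nu> + i) = ?e i + 2 * w" for i
      by (metis parity_sign_eqD)
    then obtain w where "\<And>i. i < r \<Longrightarrow> x (\<nu> + i) = ?e i + 2 * w i" by metis
    then have "\<forall>i<r. x (\<nu> + i) =
        (\<Sum>j<\<nu>. t j * of_nat (cc i j)) + 2 * w i + (\<Sum>k<r + c. z k * of_nat (b i k)) + \<eta>"
      by (simp add: algebra_simps)
    moreover have "\<forall>j<\<nu>. x j = 2 ^ n j * t j" using mt m0 by simp
    ultimately show ?rhs by blast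
  qed

  show "relation_module ?C (\<nu> + r) ?g = LinearCombinations.module.span class_ring
      (module_vec TYPE(z2) (\<nu> + r)) (set (cols (relation_matrix \<nu> r (r + c) n cc b)))"
  proof (rule Set.set_eqI)
    fix x :: "z2 vec"
    have sign_eq: "?S \<beta> = (\<lambda>i\<in>{..<r}. parity_sign (y i)) \<longleftrightarrow> (\<forall>i<r. ?S \<beta> i = parity_sign (y i))"
      if "\<beta> \<in> carrier RF" for \<beta> y
      using sign_module_eqI[OF S_closed[OF that] parity_closed[of y]] by auto
    have "(\<Oplus>\<^bsub>?C\<^esub>k\<in>{..<\<nu> + r}. x $ k \<odot>\<^bsub>?C\<^esub> ?g k) = \<zero>\<^bsub>?C\<^esub> \<longleftrightarrow>
        (\<exists>\<beta>\<in>carrier RF. ?L \<beta> = (\<lambda>v. \<Sum>j<\<nu>. x $ j * \<aa> j v) \<and>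
          (\<forall>i<r. ?S \<beta> i = parity_sign (x $ (\<nu> + i))))"
    proof -
      let ?d = "\<lambda>v. \<Sum>j<\<nu>. x $ j * \<aa> j v" and ?s = "\<lambda>i\<in>{..<r}. parity_sign (x $ (\<nu> + i))"
      have "Cl_res_class deg r \<sigma> (?d, ?s) = \<zero>\<^bsub>?C\<^esub> \<longleftrightarrow> (?d, ?s) \<in> Pl_res deg r \<sigma>"
        by (rule Cl_res_class_eq_zero_iff[OF deg \<sigma> parity_closed])
      also have "\<dots> \<longleftrightarrow> (\<exists>\<beta>\<in>carrier RF. ?L \<beta> = ?d \<and> ?S \<beta> = ?s)"
        unfolding Pl_res_def by (blast intro: sym)
      also have "\<dots> \<longleftrightarrow> (\<exists>\<beta>\<in>carrier RF. ?L \<beta> = ?d \<and> (\<forall>i<r. ?S \<beta> i = parity_sign (x $ (\<nu> + i))))"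
        using sign_eq by (intro bex_cong refl conj_cong)
      finally show ?thesis unfolding comb .
    qed
    then show "x \<in> relation_module ?C (\<nu> + r) ?g \<longleftrightarrow> x \<in> LinearCombinations.module.span class_ring
        (module_vec TYPE(z2) (\<nu> + r)) (set (cols (relation_matrix \<nu> r (r + c) n cc b)))"
      unfolding mem_span_relation_matrix_iff relation_module_def
      using relation_iff[of "\<lambda>k. x $ k"] by simp
  qed
qed

end
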